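(* Assume that $S\colon U\to Y$ satisfies the following: (1) $u_i\rightharpoonup u$ in $U$ implies $S(u_i)\rightharpoonup S(u)$ in $Y$; (2) $S$ is Fréchet differentiable; (3) $S$ is compact; (4) there is a Banach space $V$ with $U\hookrightarrow V$ and $V^*\hookrightarrow L^\infty(\Omega;\mathbb R^m)$ such that $S'(u)^*$ maps $Y$ into $V^*$ for every $u\in U$ and, for every $u\in U$ and $y\in Y$, $\|[S'(\tilde u)-S'(u)]^*y\|_{V^*}\to0$ as $\tilde u\rightharpoonup u$ in $U$; (5) $S$ is linear. Then: (i) The set of targets $z\in Y$ admitting a multibang control, i.e., for which there is a minimizer $\bar u$ of $\mathcal E^z$ over $U$ with $\bar u(x)\in\mathcal M$ for a.e. $x\in\Omega$, is dense in $Y$. (ii) Let $z\in Y$. If $S$ is injective and the minimizer $\bar u$ of $\mathcal E^z$ has a singular arc $\mathcal S_{\bar u}=\{x\in\Omega:\bar u(x)\notin\mathcal M\}$ of positive measure, then it is not true that for all sequences $z_n\to z$ in $Y$ the minimizers $u_n$ of $\mathcal E^{z_n}$ converge strongly in $U$ to $\bar u$.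
   Context: $\Omega\subset\mathbb R^n$ is a bounded open domain, $m\ge 2$, $U=L^2(\Omega;\mathbb R^m)$ (identified with its dual), and $Y$ is a (real) Hilbert space. $\mathcal M\subset\mathbb R^m$ is a (nonempty) finite set, $\alpha>0$, $c\colon\mathbb R^m\to\mathbb R$ is non-negative, strictly convex, and lower semi-continuous, and $g=(\alpha c+\delta_{\mathcal M})^{**}$ (biconjugate, i.e. convex envelope), where $\delta_{\mathcal M}$ is $0$ on $\mathcal M$ and $\infty$ elsewhere. For $z\in Y$, $\mathcal E^z(u)=\frac12\|S(u)-z\|_Y^2+\int_\Omega g(u(x))\,\mathrm dx$, $u\in U$. $S'(u)^*\colon Y\to U$ is the Hilbert-space adjoint of the Fréchet derivative $S'(u)$ (for linear $S$, $S'(u)=S$). $\hookrightarrow$ denotes continuous embedding; $V^*$ is regarded as a subspace of $L^\infty(\Omega;\mathbb R^m)\subset U$ compatibly with the embedding $U\hookrightarrow V$, i.e., the pairing of $v^*\in V^*$ with $u\in U\hookrightarrow V$ is $\int_\Omega v^*\cdot u\,\mathrm dx$. Compactness of $S$ means that bounded sets are mapped to relatively compact sets; limits under weak convergence are understood for sequences. *)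

theory Defs
  imports "HOL-Analysis.Analysis"
begin

text \<open>
  Elements of \<open>L\<^sup>2(\<Omega>)\<close> are handled through representatives: an element is a function in
  \<open>L2_space \<Omega>\<close>, and two such functions are the same element iff they agree almost
  everywhere in \<open>\<Omega>\<close>.
\<close>

definition L2_space :: "'a::euclidean_space set \<Rightarrow> ('a \<Rightarrow> 'b::euclidean_space) set" where
  "L2_space \<Omega> = {u. u \<in> borel_measurable (lebesgue_on \<Omega>) \<and>
                     integrable (lebesgue_on \<Omega>) (\<lambda>x. (norm (u x))\<^sup>2)}"

definition L2_eq :: "'a::euclidean_space set \<Rightarrow> ('a \<Rightarrow> 'b::euclidean_space) \<Rightarrow> ('a \<Rightarrow> 'b) \<Rightarrow> bool" where
  "L2_eq \<Omega> u v \<longleftrightarrow> (AE x in lebesgue_on \<Omega>. u x = v x)"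

definition L2_inner :: "'a::euclidean_space set \<Rightarrow> ('a \<Rightarrow> 'b::euclidean_space) \<Rightarrow> ('a \<Rightarrow> 'b) \<Rightarrow> real" where
  "L2_inner \<Omega> u v = (\<integral>x. u x \<bullet> v x \<partial>lebesgue_on \<Omega>)"

definition L2_norm :: "'a::euclidean_space set \<Rightarrow> ('a \<Rightarrow> 'b::euclidean_space) \<Rightarrow> real" where
  "L2_norm \<Omega> u = sqrt (L2_inner \<Omega> u u)"

definition L2_weak_conv ::
    "'a::euclidean_space set \<Rightarrow> (nat \<Rightarrow> 'a \<Rightarrow> 'b::euclidean_space) \<Rightarrow> ('a \<Rightarrow> 'b) \<Rightarrow> bool" where
  "L2_weak_conv \<Omega> us u \<longleftrightarrow> (\<forall>i. us i \<in> L2_space \<Omega>) \<and> u \<in> L2_space \<Omega> \<and>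
     (\<forall>v\<in>L2_space \<Omega>. (\<lambda>i. L2_inner \<Omega> (us i) v) \<longlonglongrightarrow> L2_inner \<Omega> u v)"

definition weak_conv :: "(nat \<Rightarrow> 'y::real_inner) \<Rightarrow> 'y \<Rightarrow> bool" where
  "weak_conv ys y \<longleftrightarrow> (\<forall>w. (\<lambda>i. ys i \<bullet> w) \<longlonglongrightarrow> y \<bullet> w)"

text \<open>Maps out of \<open>L\<^sup>2(\<Omega>)\<close>; their values outside \<open>L2_space \<Omega>\<close> are irrelevant.\<close>

definition L2_well_defined :: "'a::euclidean_space set \<Rightarrow> (('a \<Rightarrow> 'b::euclidean_space) \<Rightarrow> 'y) \<Rightarrow> bool" where
  "L2_well_defined \<Omega> T \<longleftrightarrow> (\<forall>u\<in>L2_space \<Omega>. \<forall>v\<in>L2_space \<Omega>. L2_eq \<Omega> u v \<longrightarrow> T u = T v)"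

definition L2_inj :: "'a::euclidean_space set \<Rightarrow> (('a \<Rightarrow> 'b::euclidean_space) \<Rightarrow> 'y) \<Rightarrow> bool" where
  "L2_inj \<Omega> T \<longleftrightarrow> (\<forall>u\<in>L2_space \<Omega>. \<forall>v\<in>L2_space \<Omega>. T u = T v \<longrightarrow> L2_eq \<Omega> u v)"

definition L2_linear ::
    "'a::euclidean_space set \<Rightarrow> (('a \<Rightarrow> 'b::euclidean_space) \<Rightarrow> 'y::real_vector) \<Rightarrow> bool" where
  "L2_linear \<Omega> T \<longleftrightarrow>
     (\<forall>u\<in>L2_space \<Omega>. \<forall>v\<in>L2_space \<Omega>. T (\<lambda>x. u x + v x) = T u + T v) \<and>
     (\<forall>a. \<forall>u\<in>L2_space \<Omega>. T (\<lambda>x. a *\<^sub>R u x) = a *\<^sub>R T u)"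

definition L2_bounded_linear ::
    "'a::euclidean_space set \<Rightarrow> (('a \<Rightarrow> 'b::euclidean_space) \<Rightarrow> 'y::real_normed_vector) \<Rightarrow> bool" where
  "L2_bounded_linear \<Omega> T \<longleftrightarrow> L2_linear \<Omega> T \<and>
     (\<exists>C. \<forall>u\<in>L2_space \<Omega>. norm (T u) \<le> C * L2_norm \<Omega> u)"

definition L2_has_derivative ::
    "'a::euclidean_space set \<Rightarrow> (('a \<Rightarrow> 'b::euclidean_space) \<Rightarrow> 'y::real_normed_vector) \<Rightarrow>
     (('a \<Rightarrow> 'b) \<Rightarrow> 'y) \<Rightarrow> ('a \<Rightarrow> 'b) \<Rightarrow> bool" where
  "L2_has_derivative \<Omega> S D u \<longleftrightarrow> L2_bounded_linear \<Omega> D \<and>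
     (\<forall>e>0. \<exists>d>0. \<forall>h\<in>L2_space \<Omega>. L2_norm \<Omega> h < d \<longrightarrow>
        norm (S (\<lambda>x. u x + h x) - S u - D h) \<le> e * L2_norm \<Omega> h)"

definition L2_compact_map ::
    "'a::euclidean_space set \<Rightarrow> (('a \<Rightarrow> 'b::euclidean_space) \<Rightarrow> 'y::metric_space) \<Rightarrow> bool" where
  "L2_compact_map \<Omega> S \<longleftrightarrow>
     (\<forall>B\<subseteq>L2_space \<Omega>. (\<exists>R. \<forall>u\<in>B. L2_norm \<Omega> u \<le> R) \<longrightarrow> compact (closure (S ` B)))"

text \<open>\<open>is_adjoint_value \<Omega> T y w\<close>: the function \<open>w\<close> represents the element \<open>T\<^sup>* y\<close> of \<open>L\<^sup>2(\<Omega>)\<close>,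
  where \<open>T\<^sup>*\<close> is the Hilbert-space adjoint of \<open>T\<close>.\<close>

definition is_adjoint_value ::
    "'a::euclidean_space set \<Rightarrow> (('a \<Rightarrow> 'b::euclidean_space) \<Rightarrow> 'y::real_inner) \<Rightarrow> 'y \<Rightarrow> ('a \<Rightarrow> 'b) \<Rightarrow> bool" where
  "is_adjoint_value \<Omega> T y w \<longleftrightarrow> w \<in> L2_space \<Omega> \<and> (\<forall>h\<in>L2_space \<Omega>. L2_inner \<Omega> w h = y \<bullet> T h)"

text \<open>A continuous embedding \<open>\<iota>\<close> of \<open>L\<^sup>2(\<Omega>)\<close> into \<open>V\<close>, and a continuous embedding \<open>\<kappa>\<close> of the
  dual \<open>V\<^sup>*\<close> into \<open>L\<^sup>\<infinity>(\<Omega>)\<close> (by representatives) that is compatible with \<open>\<iota>\<close>, i.e. for which the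
  duality pairing of \<open>V\<close> becomes the \<open>L\<^sup>2\<close> inner product.\<close>

definition L2_embedding ::
    "'a::euclidean_space set \<Rightarrow> (('a \<Rightarrow> 'b::euclidean_space) \<Rightarrow> 'v::real_normed_vector) \<Rightarrow> bool" where
  "L2_embedding \<Omega> \<iota> \<longleftrightarrow> L2_bounded_linear \<Omega> \<iota> \<and> L2_inj \<Omega> \<iota>"

definition dual_embedding_Linf ::
    "'a::euclidean_space set \<Rightarrow> (('a \<Rightarrow> 'b::euclidean_space) \<Rightarrow> 'v::real_normed_vector) \<Rightarrow>
     (('v \<Rightarrow>\<^sub>L real) \<Rightarrow> 'a \<Rightarrow> 'b) \<Rightarrow> bool" where
  "dual_embedding_Linf \<Omega> \<iota> \<kappa> \<longleftrightarrow>
     (\<forall>\<phi>. \<kappa> \<phi> \<in> borel_measurable (lebesgue_on \<Omega>)) \<and>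
     (\<forall>\<phi> \<psi>. L2_eq \<Omega> (\<kappa> (\<phi> + \<psi>)) (\<lambda>x. \<kappa> \<phi> x + \<kappa> \<psi> x)) \<and>
     (\<forall>a \<phi>. L2_eq \<Omega> (\<kappa> (a *\<^sub>R \<phi>)) (\<lambda>x. a *\<^sub>R \<kappa> \<phi> x)) \<and>
     (\<exists>C. \<forall>\<phi>. AE x in lebesgue_on \<Omega>. norm (\<kappa> \<phi> x) \<le> C * norm \<phi>) \<and>
     (\<forall>\<phi> \<psi>. L2_eq \<Omega> (\<kappa> \<phi>) (\<kappa> \<psi>) \<longrightarrow> \<phi> = \<psi>) \<and>
     (\<forall>\<phi>. \<forall>u\<in>L2_space \<Omega>. blinfun_apply \<phi> (\<iota> u) = L2_inner \<Omega> (\<kappa> \<phi>) u)"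

definition strictly_convex :: "('b::real_vector \<Rightarrow> real) \<Rightarrow> bool" where
  "strictly_convex c \<longleftrightarrow>
     (\<forall>v w t. v \<noteq> w \<longrightarrow> 0 < t \<longrightarrow> t < 1 \<longrightarrow>
        c ((1 - t) *\<^sub>R v + t *\<^sub>R w) < (1 - t) * c v + t * c w)"

definition lower_semicont :: "('b::topological_space \<Rightarrow> real) \<Rightarrow> bool" where
  "lower_semicont c \<longleftrightarrow> (\<forall>v. ereal (c v) \<le> Liminf (at v) (\<lambda>w. ereal (c w)))"

definition indicator_infty :: "'b set \<Rightarrow> 'b \<Rightarrow> ereal" where
  "indicator_infty M v = (if v \<in> M then 0 else \<infinity>)"

definition convex_conjugate :: "('b::real_inner \<Rightarrow> ereal) \<Rightarrow> 'b \<Rightarrow> ereal" where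
  "convex_conjugate f q = (SUP v. ereal (q \<bullet> v) - f v)"

definition multibang_penalty :: "real \<Rightarrow> ('b::real_inner \<Rightarrow> real) \<Rightarrow> 'b set \<Rightarrow> 'b \<Rightarrow> ereal" where
  "multibang_penalty \<alpha> c M =
     convex_conjugate (convex_conjugate (\<lambda>v. ereal (\<alpha> * c v) + indicator_infty M v))"

lemma multibang_penalty_nonneg:
  assumes "\<alpha> \<ge> 0" and "\<And>v. c v \<ge> 0"
  shows "multibang_penalty \<alpha> c M v \<ge> 0"
proof -
  let ?f = "\<lambda>v. ereal (\<alpha> * c v) + indicator_infty M v"
  have "ereal (0 \<bullet> w) - ?f w \<le> 0" for w
    using assms by (simp add: indicator_infty_def zero_ereal_def)
  then have "convex_conjugate ?f 0 \<le> 0"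
    unfolding convex_conjugate_def by (intro SUP_least)
  then have "0 \<le> ereal (v \<bullet> 0) - convex_conjugate ?f 0"
    by (simp add: ereal_0_le_uminus_iff zero_ereal_def[symmetric])
  also have "\<dots> \<le> multibang_penalty \<alpha> c M v"
    unfolding multibang_penalty_def convex_conjugate_def[of "convex_conjugate ?f"]
    by (rule SUP_upper) simp
  finally show ?thesis .
qed

text \<open>The functional \<open>\<E>\<^sup>z\<close>. The conversion \<open>e2ennreal\<close> truncates negative values, which do not
  occur for \<open>g = multibang_penalty \<alpha> c M\<close> (lemma \<open>multibang_penalty_nonneg\<close>).\<close>

definition energy ::
    "'a::euclidean_space set \<Rightarrow> (('a \<Rightarrow> 'b::euclidean_space) \<Rightarrow> 'y::real_normed_vector) \<Rightarrow>
     ('b \<Rightarrow> ereal) \<Rightarrow> 'y \<Rightarrow> ('a \<Rightarrow> 'b) \<Rightarrow> ennreal" where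
  "energy \<Omega> S g z u =
     ennreal (1 / 2 * (norm (S u - z))\<^sup>2) + (\<integral>\<^sup>+x. e2ennreal (g (u x)) \<partial>lebesgue_on \<Omega>)"

definition is_minimizer ::
    "'a::euclidean_space set \<Rightarrow> (('a \<Rightarrow> 'b::euclidean_space) \<Rightarrow> 'y::real_normed_vector) \<Rightarrow>
     ('b \<Rightarrow> ereal) \<Rightarrow> 'y \<Rightarrow> ('a \<Rightarrow> 'b) \<Rightarrow> bool" where
  "is_minimizer \<Omega> S g z u \<longleftrightarrow>
     u \<in> L2_space \<Omega> \<and> (\<forall>v\<in>L2_space \<Omega>. energy \<Omega> S g z u \<le> energy \<Omega> S g z v)"

definition singular_arc :: "'a set \<Rightarrow> 'b set \<Rightarrow> ('a \<Rightarrow> 'b) \<Rightarrow> 'a set" where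
  "singular_arc \<Omega> M u = {x \<in> \<Omega>. u x \<notin> M}"

end

theory Submission
  imports Defs
begin

text \<open>
  Both parts follow from one construction: arbitrarily close to every target \<open>z\<close> there is a target
  whose problem has a minimizer with values in \<open>M\<close> (lemma \<open>multibang_minimizer_nearby\<close>).

  Let \<open>u\<close> minimize the energy for \<open>z\<close> and let \<open>p = S\<^sup>*(z - S u)\<close>. For almost every \<open>x\<close>, Fenchel
  duality places \<open>u x\<close> in the convex hull of the contact set of \<open>p x\<close>, the set of those \<open>w \<in> M\<close> that
  maximize \<open>p x \<bullet> w - \<alpha> * c w\<close> (\<open>minimizer_in_hull_contact\<close>). Conversely, every control that chooses
  its values in these contact sets, and whose residual is again \<open>z - S u\<close>, is optimal
  (\<open>is_minimizer_if_contact\<close>). By rapid oscillation between the finitely many points of the contact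
  sets one finds such a selection \<open>v\<close> that is as close to \<open>u\<close> as desired when tested against
  finitely many functions (\<open>finite_selection_weakly_close\<close>), and since \<open>S\<close> is compact this makes
  \<open>S v - S u\<close> small in norm (\<open>contact_selection_close\<close>). Now shift the target to
  \<open>z' = z - S u + S v\<close>: the residual \<open>z' - S v = z - S u\<close> has not changed, so \<open>v\<close> is a minimizer for
  \<open>z'\<close>, and \<open>z'\<close> is close to \<open>z\<close>.

  Since every problem has a minimizer (\<open>minimizer_exists\<close>), this gives density. It also gives, for
  every minimizer \<open>u\<close>, targets converging to \<open>z\<close> with minimizers valued in \<open>M\<close>. If these converged
  strongly, then their limit \<open>u\<close> would take values in the closed set \<open>M\<close> almost everywhere
  (\<open>AE_in_closed_if_L2_limit\<close>), which a singular arc of positive measure excludes.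
\<close>

section \<open>The convex envelope of a cost on a finite set\<close>

definition cost_conj :: "'b::euclidean_space set \<Rightarrow> ('b \<Rightarrow> real) \<Rightarrow> 'b \<Rightarrow> real" where
  "cost_conj M a q = Max ((\<lambda>v. q \<bullet> v - a v) ` M)"

text \<open>The vectors of \<open>M\<close> between which a minimizer with dual variable \<open>q\<close> may choose; the convex
  hull of this set is the subdifferential at \<open>q\<close> of the conjugate of the cost restricted to \<open>M\<close>.\<close>

definition contact_set :: "'b::euclidean_space set \<Rightarrow> ('b \<Rightarrow> real) \<Rightarrow> 'b \<Rightarrow> 'b set" where
  "contact_set M a q = {v\<in>M. q \<bullet> v - a v = cost_conj M a q}"

text \<open>The biconjugate, with values in the extended non-negative reals that the energy integrates.
  If the cost is non-negative on \<open>M\<close>, then the truncation of negative affine minorants by \<open>ennreal\<close>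
  does not change the supremum: for \<open>q = 0\<close> the minorant is the least cost.\<close>

definition envelope :: "'b::euclidean_space set \<Rightarrow> ('b \<Rightarrow> real) \<Rightarrow> 'b \<Rightarrow> ennreal" where
  "envelope M a v = (SUP q. ennreal (q \<bullet> v - cost_conj M a q))"

locale finite_cost =
  fixes M :: "'b::euclidean_space set" and a :: "'b \<Rightarrow> real"
  assumes finite_M: "finite M" and M_nonempty: "M \<noteq> {}" and cost_nonneg: "\<And>v. v \<in> M \<Longrightarrow> 0 \<le> a v"
begin

lemma cost_conj_upper: "v \<in> M \<Longrightarrow> q \<bullet> v - a v \<le> cost_conj M a q"
  unfolding cost_conj_def using finite_M by (intro Max_ge) auto

lemma cost_conj_attained: obtains v where "v \<in> M" "q \<bullet> v - a v = cost_conj M a q"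
proof -
  have "cost_conj M a q \<in> (\<lambda>v. q \<bullet> v - a v) ` M"
    unfolding cost_conj_def using finite_M M_nonempty by (intro Max_in) auto
  then show ?thesis using that by auto
qed

lemma contact_set_nonempty: "contact_set M a q \<noteq> {}"
  using cost_conj_attained[of q] by (auto simp: contact_set_def)

lemma contact_set_subset: "contact_set M a q \<subseteq> M"
  by (auto simp: contact_set_def)

lemma convex_conjugate_eq_cost_conj:
  "convex_conjugate (\<lambda>v. ereal (a v) + indicator_infty M v) q = ereal (cost_conj M a q)"
proof -
  let ?f = "\<lambda>v. ereal (a v) + indicator_infty M v"
  obtain w where w: "w \<in> M" "q \<bullet> w - a w = cost_conj M a q"
    using cost_conj_attained .
  have "ereal (q \<bullet> v) - ?f v \<le> ereal (cost_conj M a q)" for v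
    using cost_conj_upper[of v q] by (cases "v \<in> M") (auto simp: indicator_infty_def)
  moreover have "ereal (cost_conj M a q) \<le> (SUP v. ereal (q \<bullet> v) - ?f v)"
    using w by (intro SUP_upper2[of w]) (auto simp: indicator_infty_def)
  ultimately show ?thesis
    unfolding convex_conjugate_def by (intro antisym SUP_least)
qed

lemma envelope_eq_biconjugate:
  "e2ennreal (convex_conjugate (convex_conjugate (\<lambda>v. ereal (a v) + indicator_infty M v)) v)
    = envelope M a v"
proof -
  have "e2ennreal (SUP q. ereal (v \<bullet> q - cost_conj M a q)) =
      (SUP q. e2ennreal (ereal (v \<bullet> q - cost_conj M a q)))"
    using continuous_at_Sup_mono[of e2ennreal "range (\<lambda>q. ereal (v \<bullet> q - cost_conj M a q))"]
    using continuous_at_e2ennreal monoI[of e2ennreal, OF e2ennreal_mono]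
    by (simp add: image_image)
  moreover have "convex_conjugate (\<lambda>v. ereal (a v) + indicator_infty M v) = (\<lambda>q. ereal (cost_conj M a q))"
    by (rule ext) (rule convex_conjugate_eq_cost_conj)
  ultimately show ?thesis
    by (simp add: envelope_def inner_commute convex_conjugate_def[of "\<lambda>q. ereal (cost_conj M a q)"])
qed

lemma envelope_lower: "ennreal (q \<bullet> v - cost_conj M a q) \<le> envelope M a v"
  unfolding envelope_def by (rule SUP_upper) simp

lemma envelope_le_cost:
  assumes "v \<in> M"
  shows "envelope M a v \<le> ennreal (a v)"
  unfolding envelope_def
proof (rule SUP_least)
  fix q
  show "ennreal (q \<bullet> v - cost_conj M a q) \<le> ennreal (a v)"
    using cost_conj_upper[OF assms, of q] by (intro ennreal_leI) simp
qed

text \<open>Slopes \<open>t *\<^sub>R v / norm v\<close> with large \<open>t\<close> give affine minorants that are arbitrarily large at a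
  point outside the ball. Consequently a function of finite energy takes its values in a
  ball that contains \<open>M\<close>.\<close>

lemma envelope_outside_ball:
  assumes R: "\<And>w. w \<in> M \<Longrightarrow> norm w \<le> R" and v: "R < norm v"
  shows "envelope M a v = \<infinity>"
proof -
  have "0 \<le> R"
    using R M_nonempty by (meson all_not_in_conv norm_ge_zero order_trans)
  then have v0: "norm v > 0" using v by linarith
  have bound: "ennreal (t * (norm v - R)) \<le> envelope M a v" if t: "t \<ge> 0" for t
  proof -
    let ?q = "(t / norm v) *\<^sub>R v"
    obtain w where w: "w \<in> M" "?q \<bullet> w - a w = cost_conj M a ?q" using cost_conj_attained .
    have "?q \<bullet> w \<le> norm ?q * norm w" by (rule norm_cauchy_schwarz)
    also have "\<dots> \<le> t * R" using t v0 R[OF w(1)] by (auto intro: mult_left_mono)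
    finally have "cost_conj M a ?q \<le> t * R" using w cost_nonneg by force
    moreover have "?q \<bullet> v = t * norm v"
      using v0 by (simp add: dot_square_norm power2_eq_square[of "norm v"])
    ultimately have "t * (norm v - R) \<le> ?q \<bullet> v - cost_conj M a ?q"
      by (simp add: algebra_simps)
    then show ?thesis
      by (meson ennreal_leI envelope_lower order_trans)
  qed
  show ?thesis
  proof (rule ccontr)
    assume "envelope M a v \<noteq> \<infinity>"
    then obtain r where r: "envelope M a v = ennreal r" "r \<ge> 0"
      by (cases "envelope M a v") auto
    define t where "t = (r + 1) / (norm v - R)"
    have "t \<ge> 0" "t * (norm v - R) = r + 1" using v r by (auto simp: t_def)
    then show False using bound[of t] r by simp
  qed
qed

lemma envelope_convex:
  assumes "0 \<le> t" "t \<le> 1"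
  shows "envelope M a ((1 - t) *\<^sub>R v + t *\<^sub>R w)
    \<le> ennreal (1 - t) * envelope M a v + ennreal t * envelope M a w"
  unfolding envelope_def[of _ _ "(1 - t) *\<^sub>R v + t *\<^sub>R w"]
proof (rule SUP_least)
  fix q
  let ?l = "\<lambda>v. q \<bullet> v - cost_conj M a q"
  have "?l ((1 - t) *\<^sub>R v + t *\<^sub>R w) = (1 - t) * ?l v + t * ?l w"
    by (simp add: algebra_simps inner_add_right)
  also have "ennreal \<dots> \<le> ennreal ((1 - t) * max 0 (?l v) + t * max 0 (?l w))"
    using assms by (intro ennreal_leI add_mono mult_left_mono) auto
  also have "\<dots> = ennreal (1 - t) * ennreal (?l v) + ennreal t * ennreal (?l w)"
    using assms by (simp add: ennreal_plus ennreal_mult max_def ennreal_neg)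
  also have "\<dots> \<le> ennreal (1 - t) * envelope M a v + ennreal t * envelope M a w"
    by (intro add_mono mult_left_mono envelope_lower) auto
  finally show "ennreal (?l ((1 - t) *\<^sub>R v + t *\<^sub>R w))
    \<le> ennreal (1 - t) * envelope M a v + ennreal t * envelope M a w" .
qed

lemma open_envelope_superlevel: "open {v. y < envelope M a v}"
proof -
  have "{v. y < envelope M a v} = (\<Union>q. {v. y < ennreal (q \<bullet> v - cost_conj M a q)})"
    by (auto simp: envelope_def less_SUP_iff)
  moreover have "open {v. y < ennreal (q \<bullet> v - cost_conj M a q)}" for q
    by (rule open_Collect_less)
      (rule continuous_on_const, rule continuous_on_ennreal, intro continuous_intros)
  ultimately show ?thesis
    by (simp add: open_UN)
qed

lemma borel_measurable_envelope [measurable]: "envelope M a \<in> borel_measurable borel"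
proof (rule borel_measurableI_greater)
  fix y show "{v \<in> space borel. y < envelope M a v} \<in> sets borel"
    using open_envelope_superlevel[of y] by simp
qed

lemma envelope_le_liminf:
  assumes "w \<longlonglongrightarrow> v"
  shows "envelope M a v \<le> liminf (\<lambda>n. envelope M a (w n))"
  unfolding le_Liminf_iff
proof (intro allI impI)
  fix y assume "y < envelope M a v"
  then show "\<forall>\<^sub>F n in sequentially. y < envelope M a (w n)"
    using topological_tendstoD[OF assms open_envelope_superlevel[of y]] by simp
qed

text \<open>Equality in the Fenchel inequality at \<open>(v, q)\<close> puts \<open>v\<close> into the face of the envelope exposed by
  \<open>q\<close>. If a direction \<open>d\<close> separated \<open>v\<close> strictly from the contact set, then tilting \<open>q\<close> to
  \<open>q + s *\<^sub>R d\<close> with small \<open>s > 0\<close> would increase \<open>q \<bullet> v\<close> by more than the conjugate: finitely many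
  vectors compete in the conjugate, and those outside the contact set stay behind by a gap.\<close>

lemma mem_convex_hull_contact_set:
  assumes 0: "0 \<le> q \<bullet> v - cost_conj M a q"
    and le: "envelope M a v \<le> ennreal (q \<bullet> v - cost_conj M a q)"
  shows "v \<in> convex hull contact_set M a q"
proof (rule ccontr)
  let ?H = "cost_conj M a"
  have fin: "finite (contact_set M a q)" using finite_M contact_set_subset finite_subset by blast
  assume "v \<notin> convex hull contact_set M a q"
  then obtain e b where e: "e \<bullet> v < b" "\<And>w. w \<in> convex hull contact_set M a q \<Longrightarrow> e \<bullet> w > b"
    using separating_hyperplane_closed_point[of "convex hull contact_set M a q" v]
      compact_imp_closed[OF finite_imp_compact_convex_hull[OF fin]] by auto
  define d where "d = - e"
  have d: "d \<bullet> w < d \<bullet> v" if "w \<in> contact_set M a q" for w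
    using e(1) e(2)[OF hull_inc[OF that]] by (simp add: d_def)
  have "\<forall>\<^sub>F s in at_right (0::real). (q + s *\<^sub>R d) \<bullet> w - a w < ?H q + s * (d \<bullet> v)" if w: "w \<in> M" for w
  proof (cases "w \<in> contact_set M a q")
    case True
    have "\<forall>\<^sub>F s in at_right (0::real). s > 0" by (simp add: eventually_at_right_less)
    then show ?thesis
    proof eventually_elim
      case (elim s)
      then have "s * (d \<bullet> w) < s * (d \<bullet> v)" using d[OF True] by simp
      then show ?case using True by (auto simp: contact_set_def inner_add_left)
    qed
  next
    case False
    then have less: "q \<bullet> w - a w < ?H q"
      using cost_conj_upper[OF w, of q] w by (auto simp: contact_set_def)
    have lim: "((\<lambda>s. ?H q + s * (d \<bullet> v) - ((q + s *\<^sub>R d) \<bullet> w - a w)) \<longlongrightarrow>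
        ?H q + 0 * (d \<bullet> v) - ((q + 0 *\<^sub>R d) \<bullet> w - a w)) (at_right 0)"
      by (intro tendsto_intros)
    have "\<forall>\<^sub>F s in at_right 0. 0 < ?H q + s * (d \<bullet> v) - ((q + s *\<^sub>R d) \<bullet> w - a w)"
      by (rule order_tendstoD(1)[OF lim]) (use less in simp)
    then show ?thesis by eventually_elim simp
  qed
  then have "\<forall>\<^sub>F s in at_right (0::real). \<forall>w\<in>M. (q + s *\<^sub>R d) \<bullet> w - a w < ?H q + s * (d \<bullet> v)"
    by (intro eventually_ball_finite) (auto simp: finite_M)
  then obtain s where s: "\<forall>w\<in>M. (q + s *\<^sub>R d) \<bullet> w - a w < ?H q + s * (d \<bullet> v)"
    using eventually_happens[of _ "at_right (0::real)"] by (auto simp: trivial_limit_at_right_real)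
  obtain w where "w \<in> M" "(q + s *\<^sub>R d) \<bullet> w - a w = ?H (q + s *\<^sub>R d)" using cost_conj_attained .
  then have "q \<bullet> v - ?H q < (q + s *\<^sub>R d) \<bullet> v - ?H (q + s *\<^sub>R d)"
    using s by (auto simp: inner_add_left)
  moreover have "ennreal ((q + s *\<^sub>R d) \<bullet> v - ?H (q + s *\<^sub>R d)) \<le> ennreal (q \<bullet> v - ?H q)"
    using le envelope_lower order_trans by blast
  ultimately show False using 0 by (simp add: ennreal_le_iff)
qed

lemma borel_measurable_cost_conj [measurable]: "cost_conj M a \<in> borel_measurable borel"
  unfolding cost_conj_def[abs_def] by (intro borel_measurable_Max finite_M) simp

lemma contact_set_measurable:
  "contact_set M a \<in> measurable borel (count_space (Pow M))"
proof (subst measurable_count_space_eq2)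
  have "{q. contact_set M a q = B} \<in> sets borel" if "B \<subseteq> M" for B
  proof -
    have "{q. contact_set M a q = B} =
        {q\<in>space borel. \<forall>w\<in>M. (q \<bullet> w - a w = cost_conj M a q) \<longleftrightarrow> w \<in> B}"
      using that by (auto simp: contact_set_def)
    also have "\<dots> \<in> sets borel"
      by (intro sets.sets_Collect_finite_All' finite_M M_nonempty) measurable
    finally show ?thesis .
  qed
  then show "contact_set M a \<in> space borel \<rightarrow> Pow M \<and>
      (\<forall>B\<in>Pow M. contact_set M a -` {B} \<inter> space borel \<in> sets borel)"
    using contact_set_subset by (auto simp: vimage_def)
qed (simp add: finite_M)

end

section \<open>Rounding to finite sets on atomless measure spaces\<close>

text \<open>For finite measures this intermediate value property says that there are no atoms. It makes it
  possible to realise convex combinations by dividing a set in the ratio of the weights.\<close>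

locale divisible_measure = finite_measure \<mu> for \<mu> :: "'a measure" +
  assumes divisible: "\<lbrakk>E \<in> sets \<mu>; 0 \<le> t; t \<le> measure \<mu> E\<rbrakk>
    \<Longrightarrow> \<exists>F\<in>sets \<mu>. F \<subseteq> E \<and> measure \<mu> F = t"

text \<open>The measure of \<open>E \<inter> cball 0 r\<close> depends continuously on \<open>r\<close>, since its increments are at most
  those of the volume of the balls.\<close>

lemma divisible_measure_lebesgue_on:
  fixes \<Omega> :: "'a::euclidean_space set"
  assumes \<Omega>: "\<Omega> \<in> sets lebesgue" "bounded \<Omega>"
  shows "divisible_measure (lebesgue_on \<Omega>)"
proof -
  have fm: "\<Omega> \<in> lmeasurable"
    using \<Omega> by (simp add: bounded_set_imp_lmeasurable)
  interpret finite_measure "lebesgue_on \<Omega>"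
    using fm by (intro finite_measureI) (auto simp: emeasure_restrict_space fmeasurable_def)
  show ?thesis
  proof
    fix E and t :: real
    assume E: "E \<in> sets (lebesgue_on \<Omega>)" and t: "0 \<le> t" "t \<le> measure (lebesgue_on \<Omega>) E"
    have E': "E \<in> sets lebesgue" "E \<subseteq> \<Omega>"
      using E \<Omega> by (auto simp: sets_restrict_space_iff)
    have lm: "E \<inter> cball 0 r \<in> lmeasurable" for r
      using E' \<Omega>(2) by (intro bounded_set_imp_lmeasurable) (auto intro: bounded_subset)
    define \<phi> where "\<phi> r = measure lebesgue (E \<inter> cball 0 r)" for r
    define \<psi> where "\<psi> r = unit_ball_vol (real DIM('a)) * r ^ DIM('a)" for r :: real
    have step: "\<bar>\<phi> s - \<phi> r\<bar> \<le> \<bar>\<psi> s - \<psi> r\<bar>" if "0 \<le> r" "r \<le> s" for r s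
    proof -
      have "E \<inter> cball 0 r \<subseteq> E \<inter> cball 0 s" using that by auto
      then have "\<phi> s - \<phi> r = measure lebesgue (E \<inter> cball 0 s - E \<inter> cball 0 r)" "\<phi> r \<le> \<phi> s"
        unfolding \<phi>_def using lm by (auto simp: measurable_measure_Diff fmeasurableD measure_mono_fmeasurable)
      moreover have "measure lebesgue (E \<inter> cball 0 s - E \<inter> cball 0 r)
          \<le> measure lebesgue (cball 0 s - cball (0::'a) r)"
        using lm by (intro measure_mono_fmeasurable) (auto intro: fmeasurable_Diff)
      moreover have "measure lebesgue (cball 0 s - cball (0::'a) r)
          = measure lebesgue (cball (0::'a) s) - measure lebesgue (cball (0::'a) r)"
        using that by (intro measurable_measure_Diff) auto
      ultimately show ?thesis
        using that by (simp add: content_cball \<psi>_def measure_completion)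
    qed
    have step': "\<bar>\<phi> s - \<phi> r\<bar> \<le> \<bar>\<psi> s - \<psi> r\<bar>" if "0 \<le> r" "0 \<le> s" for r s
      using step[of r s] step[of s r] that by (cases "r \<le> s") auto
    have cont: "continuous_on {0..B} \<phi>" for B
      unfolding continuous_on_def
    proof
      fix r assume r: "r \<in> {0..B}"
      have "((\<lambda>s. \<psi> s - \<psi> r) \<longlongrightarrow> \<psi> r - \<psi> r) (at r within {0..B})"
        unfolding \<psi>_def by (intro tendsto_intros)
      then have "((\<lambda>s. \<psi> s - \<psi> r) \<longlongrightarrow> 0) (at r within {0..B})" by simp
      then have "((\<lambda>s. \<phi> s - \<phi> r) \<longlongrightarrow> 0) (at r within {0..B})"
      proof (rule Lim_null_comparison[rotated, OF tendsto_rabs_zero])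
        show "\<forall>\<^sub>F s in at r within {0..B}. norm (\<phi> s - \<phi> r) \<le> \<bar>\<psi> s - \<psi> r\<bar>"
          using r step' by (auto simp: eventually_at_filter)
      qed
      then show "(\<phi> \<longlongrightarrow> \<phi> r) (at r within {0..B})"
        using LIM_zero_cancel by blast
    qed
    obtain B where "B > 0" "\<Omega> \<subseteq> ball 0 B"
      using bounded_subset_ballD[OF \<Omega>(2)] by blast
    then have B: "B > 0" "\<Omega> \<subseteq> cball 0 B"
      by auto
    have "E \<inter> cball 0 B = E" using B E' by auto
    then have "\<phi> B = measure (lebesgue_on \<Omega>) E"
      using E' \<Omega> by (simp add: \<phi>_def measure_restrict_space)
    moreover have "\<phi> 0 = 0"
      unfolding \<phi>_def using negligible_sing[of "0::'a"]
      by (intro measure_eq_0_null_sets)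
        (auto simp: negligible_iff_null_sets[symmetric] intro: negligible_subset)
    ultimately obtain r where r: "0 \<le> r" "r \<le> B" "\<phi> r = t"
      using IVT'[of \<phi> 0 t B] cont t B by auto
    moreover have "E \<inter> cball 0 r \<subseteq> \<Omega>" using E' by auto
    ultimately show "\<exists>F\<in>sets (lebesgue_on \<Omega>). F \<subseteq> E \<and> measure (lebesgue_on \<Omega>) F = t"
      using E' \<Omega> lm[of r] by (intro bexI[of _ "E \<inter> cball 0 r"])
        (auto simp: \<phi>_def measure_restrict_space sets_restrict_space_iff)
  qed
qed

context finite_measure
begin

lemma mean_in_closed_convex:
  fixes u :: "'a \<Rightarrow> 'b::euclidean_space"
  assumes u: "integrable M u" and E: "E \<in> sets M" and pos: "measure M E > 0"
    and C: "closed C" "convex C" and uC: "AE x in M. x \<in> E \<longrightarrow> u x \<in> C"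
  shows "(\<integral>x. indicator E x *\<^sub>R u x \<partial>M) /\<^sub>R measure M E \<in> C"
proof (rule ccontr)
  let ?m = "(\<integral>x. indicator E x *\<^sub>R u x \<partial>M) /\<^sub>R measure M E"
  assume "?m \<notin> C"
  then obtain d b where d: "d \<bullet> ?m < b" "\<And>w. w \<in> C \<Longrightarrow> d \<bullet> w > b"
    using separating_hyperplane_closed_point[OF C(2,1)] by metis
  have int: "integrable M (\<lambda>x. indicator E x *\<^sub>R u x)"
    using u E by (rule integrable_mult_indicator[rotated])
  have "b * measure M E = (\<integral>x. b * indicator E x \<partial>M)"
    using E by simp
  also have "\<dots> \<le> (\<integral>x. d \<bullet> (indicator E x *\<^sub>R u x) \<partial>M)"
  proof (rule integral_mono_AE)
    show "AE x in M. b * indicator E x \<le> d \<bullet> (indicator E x *\<^sub>R u x)"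
      using uC by eventually_elim (auto simp: indicator_def dest: d(2))
  qed (use integrable_inner_right[of d, OF int] E in \<open>auto simp: emeasure_eq_measure\<close>)
  also have "\<dots> = d \<bullet> (\<integral>x. indicator E x *\<^sub>R u x \<partial>M)"
    by (rule integral_inner_right) (use int in simp)
  also have "\<dots> = measure M E * (d \<bullet> ?m)"
    using pos by simp
  also have "\<dots> < measure M E * b"
    using d(1) pos by simp
  finally show False by simp
qed

end

context divisible_measure
begin

text \<open>A point of the convex hull of \<open>insert a A\<close> lies on a segment from \<open>a\<close> to a point of the
  hull of \<open>A\<close>. Dividing \<open>E\<close> in the ratio of that segment reduces the claim to \<open>A\<close>.\<close>

lemma finite_valued_with_mean:
  fixes A :: "'b::euclidean_space set"
  assumes "finite A" "A \<noteq> {}" "b \<in> convex hull A" "E \<in> sets \<mu>"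
  shows "\<exists>h\<in>borel_measurable \<mu>. (\<forall>x. h x \<in> A) \<and>
    (\<integral>x. indicator E x *\<^sub>R h x \<partial>\<mu>) = measure \<mu> E *\<^sub>R b"
  using assms
proof (induction A arbitrary: b E rule: finite_ne_induct)
  case (singleton a)
  then show ?case by (intro bexI[of _ "\<lambda>_. a"]) (auto simp: emeasure_eq_measure)
next
  case (insert a A)
  obtain s r b' where sr: "0 \<le> s" "0 \<le> r" "s + r = 1" "b' \<in> convex hull A" "b = s *\<^sub>R a + r *\<^sub>R b'"
    using insert.prems(1) insert.hyps(2) by (auto simp: convex_hull_insert)
  have "s * measure \<mu> E \<le> measure \<mu> E"
    using sr by (simp add: mult_left_le_one_le)
  then obtain F where F: "F \<in> sets \<mu>" "F \<subseteq> E" "measure \<mu> F = s * measure \<mu> E"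
    using divisible[OF insert.prems(2), of "s * measure \<mu> E"] sr by auto
  obtain h where h: "h \<in> borel_measurable \<mu>" "\<And>x. h x \<in> A"
    "(\<integral>x. indicator (E - F) x *\<^sub>R h x \<partial>\<mu>) = measure \<mu> (E - F) *\<^sub>R b'"
    using insert.IH[OF sr(4), of "E - F"] F insert.prems(2) by auto
  define k where "k x = (if x \<in> F then a else h x)" for x
  have k: "k \<in> borel_measurable \<mu>"
    unfolding k_def using F(1) h(1) by (intro measurable_If_set) auto
  obtain B where B: "\<And>x. x \<in> A \<Longrightarrow> norm x \<le> B"
    using insert.hyps(1) finite_imp_bounded bounded_iff by metis
  have "integrable \<mu> h"
    using h B by (intro integrable_const_bound[of _ B]) auto
  then have int: "integrable \<mu> (\<lambda>x. indicator (E - F) x *\<^sub>R h x)"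
    using F insert.prems(2) by (intro integrable_mult_indicator) auto
  have "(\<integral>x. indicator E x *\<^sub>R k x \<partial>\<mu>)
      = (\<integral>x. indicator F x *\<^sub>R a + indicator (E - F) x *\<^sub>R h x \<partial>\<mu>)"
    using F(2) by (intro Bochner_Integration.integral_cong) (auto simp: k_def indicator_def)
  also have "\<dots> = measure \<mu> F *\<^sub>R a + measure \<mu> (E - F) *\<^sub>R b'"
    using int F(1) by (subst Bochner_Integration.integral_add) (auto simp: h(3) emeasure_eq_measure)
  also have "measure \<mu> (E - F) = r * measure \<mu> E"
    using F insert.prems(2) sr(3) by (simp add: finite_measure_Diff algebra_simps flip: distrib_right)
  finally have "(\<integral>x. indicator E x *\<^sub>R k x \<partial>\<mu>) = measure \<mu> E *\<^sub>R b"
    using F(3) sr(5) by (simp add: scaleR_add_right mult.commute)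
  then show ?case
    using k h(2) by (intro bexI[of _ k]) (auto simp: k_def)
qed

end

lemma (in finite_measure) integrable_simple_approx:
  fixes p :: "'a \<Rightarrow> 'b::euclidean_space"
  assumes "integrable M p" "e > 0"
  obtains s where "simple_function M s" "integrable M s" "(\<integral>x. norm (p x - s x) \<partial>M) < e"
proof -
  obtain I where "has_bochner_integral M p I"
    using assms(1) by (auto elim: integrable.cases)
  then obtain s where s: "\<And>i. Bochner_Integration.simple_bochner_integrable M (s i)"
    "(\<lambda>i. \<integral>\<^sup>+x. norm (p x - s i x) \<partial>M) \<longlonglongrightarrow> 0"
    by (elim has_bochner_integral.cases) blast
  have "\<forall>\<^sub>F i in sequentially. (\<integral>\<^sup>+x. norm (p x - s i x) \<partial>M) < ennreal e"
    using s(2) assms(2) by (intro order_tendstoD(2)) auto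
  then obtain i where i: "(\<integral>\<^sup>+x. norm (p x - s i x) \<partial>M) < ennreal e"
    by (auto simp: eventually_sequentially)
  have int: "integrable M (s i)" using s(1) by (rule integrableI_simple_bochner_integrable)
  then have "(\<integral>\<^sup>+x. norm (p x - s i x) \<partial>M) = ennreal (\<integral>x. norm (p x - s i x) \<partial>M)"
    using assms(1) by (intro nn_integral_eq_integral) auto
  then have "(\<integral>x. norm (p x - s i x) \<partial>M) < e"
    using i by (simp add: ennreal_less_iff)
  then show ?thesis
    using that[of "s i"] s(1)[of i] int by (auto elim: Bochner_Integration.simple_bochner_integrable.cases)
qed

context divisible_measure
begin

lemma selection_with_same_mean:
  fixes u :: "'a \<Rightarrow> 'b::euclidean_space"
  assumes A: "finite A" "A \<noteq> {}" and E: "E \<in> sets \<mu>"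
    and u: "integrable \<mu> u" and hull: "AE x in \<mu>. x \<in> E \<longrightarrow> u x \<in> convex hull A"
  shows "\<exists>h\<in>borel_measurable \<mu>. (\<forall>x. h x \<in> A) \<and>
    (\<integral>x. indicator E x *\<^sub>R h x \<partial>\<mu>) = (\<integral>x. indicator E x *\<^sub>R u x \<partial>\<mu>)"
proof (cases "measure \<mu> E = 0")
  case True
  obtain a where "a \<in> A" using A by auto
  moreover have "E \<in> null_sets \<mu>"
    using True E by (simp add: null_sets_def emeasure_eq_measure)
  then have "AE x in \<mu>. x \<notin> E" by (rule AE_not_in)
  then have "(\<integral>x. indicator E x *\<^sub>R u x \<partial>\<mu>) = (\<integral>x. indicator E x *\<^sub>R a \<partial>\<mu>)"
    using u E by (intro integral_cong_AE) (auto elim!: eventually_mono)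
  ultimately show ?thesis
    by (intro bexI[of _ "\<lambda>_. a"]) auto
next
  case False
  then have pos: "measure \<mu> E > 0" by (simp add: zero_less_measure_iff)
  let ?m = "(\<integral>x. indicator E x *\<^sub>R u x \<partial>\<mu>) /\<^sub>R measure \<mu> E"
  have "?m \<in> convex hull A"
    using A by (intro mean_in_closed_convex u E pos hull compact_imp_closed
      finite_imp_compact_convex_hull convex_convex_hull)
  from finite_valued_with_mean[OF A this E] show ?thesis
    using pos by simp
qed

text \<open>
  The rounding lemma, an approximate form of Lyapunov's convexity theorem: a function with values
  in the hulls of finite sets \<open>K x\<close> can be replaced by a selection of \<open>K\<close> while its pairing with
  finitely many integrable functions \<open>p\<close> changes arbitrarily little. Approximate every \<open>p\<close> in
  \<open>L\<^sup>1\<close> by a simple function. The set \<open>K x\<close> and the values of the simple functions together take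
  finitely many values, hence they cut the space into finitely many pieces; on every piece \<open>v\<close> is
  chosen with the same mean as \<open>u\<close>, so that the pairings with the simple functions agree exactly.
\<close>

lemma finite_selection_weakly_close:
  fixes u :: "'a \<Rightarrow> 'b::euclidean_space" and K :: "'a \<Rightarrow> 'b set"
  assumes P: "finite P" "\<And>p. p \<in> P \<Longrightarrow> integrable \<mu> p"
    and A: "finite A" and K: "\<And>x. K x \<subseteq> A" "\<And>x. K x \<noteq> {}"
      "\<And>B. {x\<in>space \<mu>. K x = B} \<in> sets \<mu>"
    and u: "u \<in> borel_measurable \<mu>" "AE x in \<mu>. u x \<in> convex hull K x"
    and e: "e > 0"
  shows "\<exists>v\<in>borel_measurable \<mu>. (\<forall>x\<in>space \<mu>. v x \<in> K x) \<and>
    (\<forall>p\<in>P. \<bar>\<integral>x. (v x - u x) \<bullet> p x \<partial>\<mu>\<bar> < e)"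
proof -
  obtain R where R: "R > 0" "\<And>w. w \<in> A \<Longrightarrow> norm w \<le> R"
    using finite_imp_bounded[OF A] unfolding bounded_pos by auto
  have hullR: "convex hull K x \<subseteq> cball 0 R" for x
    using K(1)[of x] R by (intro hull_minimal) auto
  have uR: "AE x in \<mu>. norm (u x) \<le> R"
    using u(2) by eventually_elim (use hullR in force)
  have int_u: "integrable \<mu> u"
    using uR u(1) by (intro integrable_const_bound)
  have "\<forall>p\<in>P. \<exists>s. simple_function \<mu> s \<and> integrable \<mu> s \<and>
      (\<integral>x. norm (p x - s x) \<partial>\<mu>) < e / (2 * R)"
    using integrable_simple_approx[OF P(2), of _ "e / (2 * R)"] e R(1)
    by (metis divide_pos_pos mult_pos_pos zero_less_numeral)
  then obtain s where s: "\<And>p. p \<in> P \<Longrightarrow> simple_function \<mu> (s p)"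
    "\<And>p. p \<in> P \<Longrightarrow> integrable \<mu> (s p)"
    "\<And>p. p \<in> P \<Longrightarrow> (\<integral>x. norm (p x - s p x) \<partial>\<mu>) < e / (2 * R)"
    by metis
  \<comment> \<open>The signature of a point; its fibres are the pieces on which means are matched.\<close>
  define \<sigma> where "\<sigma> x = (K x, restrict (\<lambda>p. s p x) P)" for x
  define J where "J = \<sigma> ` space \<mu>"
  define E where "E k = {x\<in>space \<mu>. \<sigma> x = k}" for k
  have finJ: "finite J"
  proof (rule finite_subset)
    show "J \<subseteq> Pow A \<times> PiE P (\<lambda>p. s p ` space \<mu>)"
      using K(1) by (auto simp: J_def \<sigma>_def)
    show "finite (Pow A \<times> PiE P (\<lambda>p. s p ` space \<mu>))"
      using A P(1) s(1) by (auto intro!: finite_PiE dest: simple_functionD(1))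
  qed
  have E: "E k \<in> sets \<mu>" if k: "k \<in> J" for k
  proof -
    obtain y where y: "k = \<sigma> y" using k by (auto simp: J_def)
    have restrict_eq: "restrict f P = restrict g P \<longleftrightarrow> (\<forall>p\<in>P. f p = g p)" for f g :: "('a \<Rightarrow> 'b) \<Rightarrow> 'b"
      by (metis restrict_apply' restrict_ext)
    have eq: "E k = {x\<in>space \<mu>. K x = K y \<and> (\<forall>p\<in>P. s p x = s p y)}"
      unfolding E_def y \<sigma>_def prod.inject restrict_eq ..
    have "{x\<in>space \<mu>. s p x = s p y} \<in> sets \<mu>" if "p \<in> P" for p
      using simple_functionD(2)[OF s(1)[OF that], of "{s p y}"]
      by (simp add: vimage_def Int_def conj_commute)
    then show ?thesis
      unfolding eq by (intro sets.sets_Collect_conj sets.sets_Collect_finite_All K(3) P(1))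
  qed
  have "\<forall>k\<in>J. \<exists>h\<in>borel_measurable \<mu>. (\<forall>x. h x \<in> fst k) \<and>
    (\<integral>x. indicator (E k) x *\<^sub>R h x \<partial>\<mu>) = (\<integral>x. indicator (E k) x *\<^sub>R u x \<partial>\<mu>)"
  proof
    fix k assume k: "k \<in> J"
    have "finite (fst k)" "fst k \<noteq> {}"
      using k K(2) finite_subset[OF K(1) A] by (auto simp: J_def \<sigma>_def)
    moreover have "AE x in \<mu>. x \<in> E k \<longrightarrow> u x \<in> convex hull fst k"
      using u(2) by eventually_elim (auto simp: E_def \<sigma>_def)
    ultimately show "\<exists>h\<in>borel_measurable \<mu>. (\<forall>x. h x \<in> fst k) \<and>
        (\<integral>x. indicator (E k) x *\<^sub>R h x \<partial>\<mu>) = (\<integral>x. indicator (E k) x *\<^sub>R u x \<partial>\<mu>)"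
      using E[OF k] int_u by (intro selection_with_same_mean)
  qed
  then obtain h where h: "\<And>k. k \<in> J \<Longrightarrow> h k \<in> borel_measurable \<mu>"
    "\<And>k x. k \<in> J \<Longrightarrow> h k x \<in> fst k"
    "\<And>k. k \<in> J \<Longrightarrow> (\<integral>x. indicator (E k) x *\<^sub>R h k x \<partial>\<mu>) = (\<integral>x. indicator (E k) x *\<^sub>R u x \<partial>\<mu>)"
    by metis
  have fstJ: "fst k \<subseteq> A" if "k \<in> J" for k
    using that subsetD[OF K(1)] by (auto simp: J_def \<sigma>_def)
  have int_h: "integrable \<mu> (h k)" if "k \<in> J" for k
    using h(1,2)[OF that] fstJ[OF that] R(2) by (intro integrable_const_bound[of _ R]) auto
  define v where "v x = (\<Sum>k\<in>J. indicator (E k) x *\<^sub>R h k x)" for x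
  have v_eq: "v x = h (\<sigma> x) x" if "x \<in> space \<mu>" for x
  proof -
    have "v x = (\<Sum>k\<in>{\<sigma> x}. indicator (E k) x *\<^sub>R h k x)"
      unfolding v_def using finJ that
      by (intro sum.mono_neutral_right) (auto simp: J_def E_def indicator_def)
    then show ?thesis using that by (simp add: E_def)
  qed
  have v_meas: "v \<in> borel_measurable \<mu>"
    unfolding v_def by (intro borel_measurable_sum borel_measurable_scaleR borel_measurable_indicator E h(1))
  have v_in: "v x \<in> K x" if "x \<in> space \<mu>" for x
    using v_eq[OF that] h(2)[of "\<sigma> x" x] that by (simp add: J_def \<sigma>_def)
  have "\<bar>\<integral>x. (v x - u x) \<bullet> p x \<partial>\<mu>\<bar> < e" if p: "p \<in> P" for p
  proof -
    have vuR: "AE x in \<mu>. norm (v x - u x) \<le> 2 * R"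
      using uR AE_space
    proof eventually_elim
      case (elim x)
      then show ?case
        using norm_triangle_ineq4[of "v x" "u x"] v_in[of x] K(1)[of x] R(2)[of "v x"] by auto
    qed
    have vu: "(\<lambda>x. v x - u x) \<in> borel_measurable \<mu>"
      using v_meas u(1) by measurable
    have int_mult: "integrable \<mu> (\<lambda>x. (v x - u x) \<bullet> f x)" if f: "integrable \<mu> f" for f
    proof (rule Bochner_Integration.integrable_bound)
      show "integrable \<mu> (\<lambda>x. 2 * R * norm (f x))" using f by auto
      show "(\<lambda>x. (v x - u x) \<bullet> f x) \<in> borel_measurable \<mu>" using vu f by measurable
      show "AE x in \<mu>. norm ((v x - u x) \<bullet> f x) \<le> norm (2 * R * norm (f x))"
        using vuR
      proof eventually_elim
        case (elim x)
        have "\<bar>(v x - u x) \<bullet> f x\<bar> \<le> norm (v x - u x) * norm (f x)"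
          by (rule Cauchy_Schwarz_ineq2)
        also have "\<dots> \<le> 2 * R * norm (f x)" using elim by (intro mult_right_mono) auto
        finally show ?case using R(1) by simp
      qed
    qed
    have "(\<integral>x. (v x - u x) \<bullet> s p x \<partial>\<mu>)
        = (\<integral>x. (\<Sum>k\<in>J. (indicator (E k) x *\<^sub>R h k x - indicator (E k) x *\<^sub>R u x) \<bullet> snd k p) \<partial>\<mu>)"
    proof (intro Bochner_Integration.integral_cong refl)
      fix x assume x: "x \<in> space \<mu>"
      have "(\<Sum>k\<in>J. (indicator (E k) x *\<^sub>R h k x - indicator (E k) x *\<^sub>R u x) \<bullet> snd k p)
        = (\<Sum>k\<in>{\<sigma> x}. (indicator (E k) x *\<^sub>R h k x - indicator (E k) x *\<^sub>R u x) \<bullet> snd k p)"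
        using finJ x by (intro sum.mono_neutral_right) (auto simp: J_def E_def indicator_def)
      also have "\<dots> = (v x - u x) \<bullet> s p x"
        using x p v_eq[OF x] by (simp add: E_def) (simp add: \<sigma>_def)
      finally show "(v x - u x) \<bullet> s p x = (\<Sum>k\<in>J. (indicator (E k) x *\<^sub>R h k x - indicator (E k) x *\<^sub>R u x) \<bullet> snd k p)"
        by simp
    qed
    also have "\<dots> = (\<Sum>k\<in>J. ((\<integral>x. indicator (E k) x *\<^sub>R h k x \<partial>\<mu>) - (\<integral>x. indicator (E k) x *\<^sub>R u x \<partial>\<mu>)) \<bullet> snd k p)"
    proof -
      have 1: "integrable \<mu> (\<lambda>x. indicator (E k) x *\<^sub>R h k x)" "integrable \<mu> (\<lambda>x. indicator (E k) x *\<^sub>R u x)"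
        if "k \<in> J" for k
        using E[OF that] int_h[OF that] int_u by (auto intro!: integrable_mult_indicator)
      have 2: "integrable \<mu> (\<lambda>x. indicator (E k) x *\<^sub>R h k x - indicator (E k) x *\<^sub>R u x)"
        if "k \<in> J" for k
        using 1[OF that] by (rule Bochner_Integration.integrable_diff)
      have "(\<integral>x. (indicator (E k) x *\<^sub>R h k x - indicator (E k) x *\<^sub>R u x) \<bullet> snd k p \<partial>\<mu>)
          = ((\<integral>x. indicator (E k) x *\<^sub>R h k x \<partial>\<mu>) - (\<integral>x. indicator (E k) x *\<^sub>R u x \<partial>\<mu>)) \<bullet> snd k p"
        if "k \<in> J" for k
        using Bochner_Integration.integral_diff[OF 1[OF that]] integral_inner_left[of "snd k p", OF 2[OF that]]
        by simp
      then show ?thesis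
        using integrable_inner_left[OF 2] by (subst Bochner_Integration.integral_sum) auto
    qed
    also have "\<dots> = 0" using h(3) by simp
    finally have 0: "(\<integral>x. (v x - u x) \<bullet> s p x \<partial>\<mu>) = 0" .
    have "(\<integral>x. (v x - u x) \<bullet> p x \<partial>\<mu>) = (\<integral>x. (v x - u x) \<bullet> (p x - s p x) \<partial>\<mu>)"
      using 0 int_mult[OF P(2)[OF p]] int_mult[OF s(2)[OF p]]
      by (simp add: inner_diff_right Bochner_Integration.integral_diff)
    also have "\<bar>\<dots>\<bar> \<le> (\<integral>x. 2 * R * norm (p x - s p x) \<partial>\<mu>)"
    proof -
      have int: "integrable \<mu> (\<lambda>x. p x - s p x)" using P(2) s(2) p by auto
      have "\<bar>\<integral>x. (v x - u x) \<bullet> (p x - s p x) \<partial>\<mu>\<bar> \<le> (\<integral>x. \<bar>(v x - u x) \<bullet> (p x - s p x)\<bar> \<partial>\<mu>)"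
        using integral_norm_bound[of \<mu> "\<lambda>x. (v x - u x) \<bullet> (p x - s p x)"] by simp
      also have "\<dots> \<le> (\<integral>x. 2 * R * norm (p x - s p x) \<partial>\<mu>)"
      proof (rule integral_mono_AE)
        show "AE x in \<mu>. \<bar>(v x - u x) \<bullet> (p x - s p x)\<bar> \<le> 2 * R * norm (p x - s p x)"
          using vuR
        proof eventually_elim
          case (elim x)
          have "\<bar>(v x - u x) \<bullet> (p x - s p x)\<bar> \<le> norm (v x - u x) * norm (p x - s p x)"
            by (rule Cauchy_Schwarz_ineq2)
          also have "\<dots> \<le> 2 * R * norm (p x - s p x)" using elim by (intro mult_right_mono) auto
          finally show ?case .
        qed
      qed (use int_mult[OF int] int in auto)
      finally show ?thesis .
    qed
    also have "\<dots> < e"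
      using s(3)[OF p] R(1) by (simp add: field_simps)
    finally show ?thesis .
  qed
  then show ?thesis
    using v_meas v_in by auto
qed

end

section \<open>Square-integrable functions\<close>

lemma L2_spaceI_le:
  assumes "u \<in> borel_measurable (lebesgue_on \<Omega>)" "integrable (lebesgue_on \<Omega>) f"
    and "AE x in lebesgue_on \<Omega>. (norm (u x))\<^sup>2 \<le> f x"
  shows "u \<in> L2_space \<Omega>"
proof -
  have "integrable (lebesgue_on \<Omega>) (\<lambda>x. (norm (u x))\<^sup>2)"
  proof (rule Bochner_Integration.integrable_bound[OF assms(2)])
    show "AE x in lebesgue_on \<Omega>. norm ((norm (u x))\<^sup>2) \<le> norm (f x)"
      using assms(3) by eventually_elim auto
  qed (use assms(1) in measurable)
  then show ?thesis using assms(1) by (simp add: L2_space_def)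
qed

lemma norm_add_sq_le: "(norm (x + y))\<^sup>2 \<le> 2 * (norm x)\<^sup>2 + 2 * (norm (y :: 'b::real_inner))\<^sup>2"
proof -
  have "0 \<le> (norm (x - y))\<^sup>2" by simp
  then show ?thesis
    by (simp add: power2_norm_eq_inner inner_add_left inner_add_right inner_diff_left inner_diff_right inner_commute)
qed

lemma L2_space_measurable: "u \<in> L2_space \<Omega> \<Longrightarrow> u \<in> borel_measurable (lebesgue_on \<Omega>)"
  by (simp add: L2_space_def)

lemma L2_space_integrable_sq: "u \<in> L2_space \<Omega> \<Longrightarrow> integrable (lebesgue_on \<Omega>) (\<lambda>x. (norm (u x))\<^sup>2)"
  by (simp add: L2_space_def)

lemma L2_space_add:
  assumes "u \<in> L2_space \<Omega>" "v \<in> L2_space \<Omega>"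
  shows "(\<lambda>x. u x + v x) \<in> L2_space \<Omega>"
proof (rule L2_spaceI_le)
  show "(\<lambda>x. u x + v x) \<in> borel_measurable (lebesgue_on \<Omega>)"
    using assms[THEN L2_space_measurable] by measurable
  show "integrable (lebesgue_on \<Omega>) (\<lambda>x. 2 * (norm (u x))\<^sup>2 + 2 * (norm (v x))\<^sup>2)"
    using assms[THEN L2_space_integrable_sq] by auto
qed (simp add: norm_add_sq_le)

lemma L2_space_scaleR:
  assumes "u \<in> L2_space \<Omega>"
  shows "(\<lambda>x. a *\<^sub>R u x) \<in> L2_space \<Omega>"
proof (rule L2_spaceI_le)
  show "(\<lambda>x. a *\<^sub>R u x) \<in> borel_measurable (lebesgue_on \<Omega>)"
    using assms[THEN L2_space_measurable] by measurable
  show "integrable (lebesgue_on \<Omega>) (\<lambda>x. a\<^sup>2 * (norm (u x))\<^sup>2)"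
    using assms[THEN L2_space_integrable_sq] by auto
qed (simp add: power_mult_distrib)

lemma L2_space_diff:
  assumes "u \<in> L2_space \<Omega>" "v \<in> L2_space \<Omega>"
  shows "(\<lambda>x. u x - v x) \<in> L2_space \<Omega>"
  using L2_space_add[OF assms(1) L2_space_scaleR[OF assms(2), of "-1"]] by simp

lemma L2_space_integrable_inner:
  assumes "u \<in> L2_space \<Omega>" "v \<in> L2_space \<Omega>"
  shows "integrable (lebesgue_on \<Omega>) (\<lambda>x. u x \<bullet> v x)"
proof (rule Bochner_Integration.integrable_bound)
  show "integrable (lebesgue_on \<Omega>) (\<lambda>x. (norm (u x))\<^sup>2 + (norm (v x))\<^sup>2)"
    using assms[THEN L2_space_integrable_sq] by auto
  show "(\<lambda>x. u x \<bullet> v x) \<in> borel_measurable (lebesgue_on \<Omega>)"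
    using assms[THEN L2_space_measurable] by measurable
  have "\<bar>x \<bullet> y\<bar> \<le> (norm x)\<^sup>2 + (norm y)\<^sup>2" for x y :: 'b
  proof -
    have "\<bar>x \<bullet> y\<bar> \<le> norm x * norm y" by (rule Cauchy_Schwarz_ineq2)
    also have "\<dots> \<le> (norm x)\<^sup>2 + (norm y)\<^sup>2"
      using sum_squares_bound[of "norm x" "norm y"] mult_nonneg_nonneg[of "norm x" "norm y"]
      unfolding mult.assoc by (smt (verit) norm_ge_zero)
    finally show ?thesis .
  qed
  then show "AE x in lebesgue_on \<Omega>. norm (u x \<bullet> v x) \<le> norm ((norm (u x))\<^sup>2 + (norm (v x))\<^sup>2)"
    by auto
qed

lemma L2_norm_eq: "L2_norm \<Omega> u = sqrt (\<integral>x. (norm (u x))\<^sup>2 \<partial>lebesgue_on \<Omega>)"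
  by (simp add: L2_norm_def L2_inner_def power2_norm_eq_inner)

lemma L2_parallelogram:
  assumes "u \<in> L2_space \<Omega>" "v \<in> L2_space \<Omega>"
  shows "(\<integral>x. (norm (u x - v x))\<^sup>2 \<partial>lebesgue_on \<Omega>) =
    2 * (\<integral>x. (norm (u x))\<^sup>2 \<partial>lebesgue_on \<Omega>) + 2 * (\<integral>x. (norm (v x))\<^sup>2 \<partial>lebesgue_on \<Omega>) -
    4 * (\<integral>x. (norm ((1/2) *\<^sub>R u x + (1/2) *\<^sub>R v x))\<^sup>2 \<partial>lebesgue_on \<Omega>)"
proof -
  have "(norm (x - y))\<^sup>2 = 2 * (norm x)\<^sup>2 + 2 * (norm y)\<^sup>2 - 4 * (norm ((1/2) *\<^sub>R x + (1/2) *\<^sub>R y))\<^sup>2" for x y :: 'b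
    unfolding power2_norm_eq_inner
    by (simp add: inner_add_left inner_add_right inner_diff_left inner_diff_right inner_commute algebra_simps)
  moreover have "integrable (lebesgue_on \<Omega>) (\<lambda>x. (norm ((1/2) *\<^sub>R u x + (1/2) *\<^sub>R v x))\<^sup>2)"
    using assms by (intro L2_space_integrable_sq L2_space_add L2_space_scaleR)
  ultimately show ?thesis
    using assms[THEN L2_space_integrable_sq] by simp
qed

lemma L2_norm_scaleR: "L2_norm \<Omega> (\<lambda>x. t *\<^sub>R u x) = \<bar>t\<bar> * L2_norm \<Omega> u"
  by (simp add: L2_norm_eq power_mult_distrib real_sqrt_mult)

lemma L2_norm_nonneg: "0 \<le> L2_norm \<Omega> u"
  by (simp add: L2_norm_eq)

context
  fixes \<Omega> :: "'a::euclidean_space set"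
  assumes fin: "finite_measure (lebesgue_on \<Omega>)"
begin

interpretation finite_measure "lebesgue_on \<Omega>" by (rule fin)

lemma L2_space_bounded:
  assumes "u \<in> borel_measurable (lebesgue_on \<Omega>)" "AE x in lebesgue_on \<Omega>. norm (u x) \<le> B"
  shows "u \<in> L2_space \<Omega>"
proof (rule L2_spaceI_le[OF assms(1)])
  show "AE x in lebesgue_on \<Omega>. (norm (u x))\<^sup>2 \<le> B\<^sup>2"
    using assms(2) by eventually_elim (simp add: power_mono)
qed auto

lemma L2_space_integrable:
  assumes "u \<in> L2_space \<Omega>"
  shows "integrable (lebesgue_on \<Omega>) u"
proof (rule Bochner_Integration.integrable_bound)
  show "integrable (lebesgue_on \<Omega>) (\<lambda>x. 1 + (norm (u x))\<^sup>2)"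
    using assms[THEN L2_space_integrable_sq] by auto
  have "t \<le> 1 + t\<^sup>2" for t :: real
    using sum_squares_bound[of t 1] zero_le_power2[of t] unfolding power_one by linarith
  then show "AE x in lebesgue_on \<Omega>. norm (u x) \<le> norm (1 + (norm (u x))\<^sup>2)"
    by auto
qed (rule L2_space_measurable[OF assms])

text \<open>
  A substitute for weak compactness. Take in every \<open>K n\<close> an element whose norm is nearly minimal.
  As the midpoint of two of them lies again in the larger set, the parallelogram law makes the
  sequence Cauchy, so that it converges strongly in \<open>L\<^sup>2\<close> and, along a subsequence, almost everywhere.
\<close>

lemma nested_midpoint_convex_limit:
  fixes K :: "nat \<Rightarrow> ('a \<Rightarrow> 'b::euclidean_space) set"
  assumes dec: "decseq K" and ne: "\<And>n. K n \<noteq> {}" and L2: "\<And>n. K n \<subseteq> L2_space \<Omega>"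
    and mid: "\<And>n u v. u \<in> K n \<Longrightarrow> v \<in> K n \<Longrightarrow> (\<lambda>x. (1/2) *\<^sub>R u x + (1/2) *\<^sub>R v x) \<in> K n"
    and bnd: "\<And>n u. u \<in> K n \<Longrightarrow> AE x in lebesgue_on \<Omega>. norm (u x) \<le> R"
  obtains w u where "w \<in> L2_space \<Omega>" "\<And>n. u n \<in> K n"
    "AE x in lebesgue_on \<Omega>. (\<lambda>n. u n x) \<longlonglongrightarrow> w x"
    "(\<lambda>n. L2_norm \<Omega> (\<lambda>x. u n x - w x)) \<longlonglongrightarrow> 0"
proof -
  define N where "N u = (\<integral>x. (norm (u x))\<^sup>2 \<partial>lebesgue_on \<Omega>)" for u :: "'a \<Rightarrow> 'b"
  define d where "d n = Inf (N ` K n)" for n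
  have N0: "0 \<le> N u" for u unfolding N_def by simp
  have bdd: "bdd_below (N ` K n)" for n
    using N0 by (auto intro!: bdd_belowI[of _ 0])
  have d_le: "d n \<le> N u" if "u \<in> K n" for n u
    unfolding d_def using bdd that by (intro cInf_lower) auto
  have "incseq d"
    unfolding incseq_def d_def using decseqD[OF dec] ne bdd
    by (intro allI impI cInf_superset_mono image_mono) auto
  moreover have "d n \<le> R\<^sup>2 * measure (lebesgue_on \<Omega>) (space (lebesgue_on \<Omega>))" for n
  proof -
    obtain u where u: "u \<in> K n" using ne[of n] by auto
    have "N u \<le> (\<integral>x. R\<^sup>2 \<partial>lebesgue_on \<Omega>)"
      unfolding N_def
    proof (rule integral_mono_AE)
      show "AE x in lebesgue_on \<Omega>. (norm (u x))\<^sup>2 \<le> R\<^sup>2"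
        using bnd[OF u] by eventually_elim (simp add: power_mono)
      show "integrable (lebesgue_on \<Omega>) (\<lambda>x. (norm (u x))\<^sup>2)"
        using u L2 L2_space_integrable_sq by blast
    qed auto
    then show ?thesis using d_le[OF u] by (simp add: mult.commute)
  qed
  ultimately obtain L where L: "d \<longlonglongrightarrow> L" "\<And>n. d n \<le> L"
    using incseq_convergent[of d "R\<^sup>2 * measure (lebesgue_on \<Omega>) (space (lebesgue_on \<Omega>))"] by metis
  have "\<exists>u. u \<in> K n \<and> N u < d n + 1 / real (Suc n)" for n
    using cInf_lessD[of "N ` K n" "d n + 1 / real (Suc n)"] ne[of n] by (auto simp: d_def)
  then obtain w where w: "\<And>n. w n \<in> K n" "\<And>n. N (w n) < d n + 1 / real (Suc n)"
    by metis
  have wL2: "w n \<in> L2_space \<Omega>" for n using w(1) L2 by blast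
  define \<eta> where "\<eta> n = 4 * (L - d n) + 4 / real (Suc n)" for n
  have \<eta>: "\<eta> \<longlonglongrightarrow> 0"
  proof -
    have "(\<lambda>n. 4 * (L - d n) + 4 * inverse (real (Suc n))) \<longlonglongrightarrow> 4 * (L - L) + 4 * 0"
      by (intro tendsto_intros L(1) LIMSEQ_inverse_real_of_nat)
    then show ?thesis by (simp add: \<eta>_def[abs_def] inverse_eq_divide)
  qed
  have near: "(\<integral>x. (norm (w i x - w j x))\<^sup>2 \<partial>lebesgue_on \<Omega>) \<le> \<eta> n" if "n \<le> i" "n \<le> j" for n i j
  proof -
    have "w i \<in> K n" "w j \<in> K n" using w(1) that decseqD[OF dec] by blast+
    then have "d n \<le> N (\<lambda>x. (1/2) *\<^sub>R w i x + (1/2) *\<^sub>R w j x)"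
      by (intro d_le mid)
    moreover have "1 / real (Suc i) \<le> 1 / real (Suc n)" "1 / real (Suc j) \<le> 1 / real (Suc n)"
      using that by (auto intro!: divide_left_mono)
    ultimately show ?thesis
      using L2_parallelogram[OF wL2[of i] wL2[of j]] w(2)[of i] w(2)[of j] L(2)[of i] L(2)[of j]
      unfolding N_def \<eta>_def by argo
  qed
  have cauchy: "\<exists>n. \<forall>i\<ge>n. \<forall>j\<ge>n. (\<integral>x. norm (w i x - w j x) \<partial>lebesgue_on \<Omega>) < e" if e: "e > 0" for e
  proof -
    define m where "m = measure (lebesgue_on \<Omega>) (space (lebesgue_on \<Omega>))"
    \<comment> \<open>In \<open>t \<le> \<delta> + t\<^sup>2 / \<delta>\<close> the constant part integrates to at most \<open>e / 2\<close>.\<close>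
    define \<delta> where "\<delta> = e / (2 * (m + 1))"
    have m: "m \<ge> 0" by (simp add: m_def)
    have \<delta>: "\<delta> > 0" and \<delta>m: "\<delta> * m \<le> e / 2"
      using e m by (auto simp: \<delta>_def field_simps)
    have "\<forall>\<^sub>F n in sequentially. \<eta> n < \<delta> * (e / 2)"
      using \<eta> \<delta> e by (intro order_tendstoD(2)) auto
    then obtain n where n: "\<eta> n < \<delta> * (e / 2)"
      by (auto simp: eventually_sequentially)
    show ?thesis
    proof (intro exI[of _ n] allI impI)
      fix i j assume ij: "n \<le> i" "n \<le> j"
      have diff: "(\<lambda>x. w i x - w j x) \<in> L2_space \<Omega>" by (intro L2_space_diff wL2)
      have "(\<integral>x. norm (w i x - w j x) \<partial>lebesgue_on \<Omega>)
          \<le> (\<integral>x. \<delta> + (norm (w i x - w j x))\<^sup>2 / \<delta> \<partial>lebesgue_on \<Omega>)"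
      proof (rule integral_mono)
        show "integrable (lebesgue_on \<Omega>) (\<lambda>x. norm (w i x - w j x))"
          using L2_space_integrable[OF diff] by auto
        show "integrable (lebesgue_on \<Omega>) (\<lambda>x. \<delta> + (norm (w i x - w j x))\<^sup>2 / \<delta>)"
          using L2_space_integrable_sq[OF diff] by auto
        have "t \<le> \<delta> + t\<^sup>2 / \<delta>" if "t \<ge> 0" for t
        proof (cases "t \<le> \<delta>")
          case True
          moreover have "0 \<le> t\<^sup>2 / \<delta>" using \<delta> by auto
          ultimately show ?thesis by linarith
        next
          case False
          then have "t * \<delta> \<le> t\<^sup>2" using that by (simp add: power2_eq_square mult_left_mono)
          then have "t \<le> t\<^sup>2 / \<delta>" using \<delta> by (simp add: field_simps)
          then show ?thesis using \<delta> by linarith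
        qed
        then show "norm (w i x - w j x) \<le> \<delta> + (norm (w i x - w j x))\<^sup>2 / \<delta>" for x
          by simp
      qed
      also have "\<dots> = \<delta> * m + (\<integral>x. (norm (w i x - w j x))\<^sup>2 \<partial>lebesgue_on \<Omega>) / \<delta>"
        using L2_space_integrable_sq[OF diff] by (simp add: m_def mult.commute)
      also have "\<dots> \<le> e / 2 + \<eta> n / \<delta>"
        using \<delta>m near[OF ij] \<delta>(1) by (intro add_mono divide_right_mono) auto
      also have "\<dots> < e"
        using n \<delta>(1) by (simp add: field_simps)
      finally show "(\<integral>x. norm (w i x - w j x) \<partial>lebesgue_on \<Omega>) < e" .
    qed
  qed
  obtain r where r: "strict_mono r" "AE x in lebesgue_on \<Omega>. Cauchy (\<lambda>i. w (r i) x)"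
    using cauchy_L1_AE_cauchy_subseq[of "lebesgue_on \<Omega>" w] L2_space_integrable[OF wL2] cauchy by blast
  define W where "W x = lim (\<lambda>i. w (r i) x)" for x
  have conv: "AE x in lebesgue_on \<Omega>. (\<lambda>i. w (r i) x) \<longlonglongrightarrow> W x"
    using r(2) by eventually_elim (simp add: W_def Cauchy_convergent_iff convergent_LIMSEQ_iff)
  have W_meas: "W \<in> borel_measurable (lebesgue_on \<Omega>)"
    unfolding W_def using wL2[THEN L2_space_measurable] by (intro borel_measurable_lim_metric)
  have all_bnd: "AE x in lebesgue_on \<Omega>. \<forall>i. norm (w (r i) x) \<le> R"
    unfolding AE_all_countable using bnd[OF w(1)] by blast
  have W_bnd: "AE x in lebesgue_on \<Omega>. norm (W x) \<le> R"
    using conv all_bnd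
  proof eventually_elim
    case (elim x)
    then show ?case by (intro LIMSEQ_le_const2[OF tendsto_norm]) auto
  qed
  have WL2: "W \<in> L2_space \<Omega>"
    using W_meas W_bnd by (rule L2_space_bounded)
  have "(\<lambda>n. \<integral>x. (norm (w (r n) x - W x))\<^sup>2 \<partial>lebesgue_on \<Omega>) \<longlonglongrightarrow> (\<integral>x. 0 \<partial>lebesgue_on \<Omega>)"
  proof (rule integral_dominated_convergence[where w = "\<lambda>_. (2 * R)\<^sup>2"])
    show "(\<lambda>x. (norm (w (r n) x - W x))\<^sup>2) \<in> borel_measurable (lebesgue_on \<Omega>)" for n
      using W_meas wL2[THEN L2_space_measurable] by measurable
    show "AE x in lebesgue_on \<Omega>. (\<lambda>n. (norm (w (r n) x - W x))\<^sup>2) \<longlonglongrightarrow> 0"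
      using conv
    proof eventually_elim
      case (elim x)
      then have "(\<lambda>n. (norm (w (r n) x - W x))\<^sup>2) \<longlonglongrightarrow> (norm (W x - W x))\<^sup>2"
        by (intro tendsto_intros)
      then show ?case by simp
    qed
    show "AE x in lebesgue_on \<Omega>. norm ((norm (w (r n) x - W x))\<^sup>2) \<le> (2 * R)\<^sup>2" for n
      using all_bnd W_bnd
    proof eventually_elim
      case (elim x)
      then have "norm (w (r n) x - W x) \<le> 2 * R"
        using norm_triangle_ineq4[of "w (r n) x" "W x"] spec[OF elim(1), of n] by linarith
      then have "(norm (w (r n) x - W x))\<^sup>2 \<le> (2 * R)\<^sup>2" by (rule power_mono) simp
      then show ?case by simp
    qed
  qed auto
  then have "(\<lambda>n. L2_norm \<Omega> (\<lambda>x. w (r n) x - W x)) \<longlonglongrightarrow> sqrt 0"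
    unfolding L2_norm_eq by (intro tendsto_real_sqrt) simp
  moreover have "w (r n) \<in> K n" for n
    using w(1)[of "r n"] decseqD[OF dec seq_suble[OF r(1), of n]] by auto
  ultimately show ?thesis
    using that[OF WL2, of "\<lambda>n. w (r n)"] conv by simp
qed

end

text \<open>By homogeneity the remainder estimate near \<open>0\<close> holds along the whole ray through \<open>h\<close>, with
  every constant \<open>e > 0\<close>.\<close>

lemma L2_linear_derivative_unique:
  assumes S: "L2_linear \<Omega> S" and D: "L2_has_derivative \<Omega> S D u"
    and u: "u \<in> L2_space \<Omega>" and h: "h \<in> L2_space \<Omega>"
  shows "D h = S h"
proof -
  have lin: "L2_linear \<Omega> D" using D by (simp add: L2_has_derivative_def L2_bounded_linear_def)
  have *: "norm (S h - D h) \<le> e * L2_norm \<Omega> h" if e: "e > 0" for e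
  proof -
    obtain d where d: "d > 0" "\<And>k. k \<in> L2_space \<Omega> \<Longrightarrow> L2_norm \<Omega> k < d \<Longrightarrow>
        norm (S (\<lambda>x. u x + k x) - S u - D k) \<le> e * L2_norm \<Omega> k"
      using D e unfolding L2_has_derivative_def by metis
    define t where "t = d / (L2_norm \<Omega> h + 1)"
    have t: "t > 0" using d(1) L2_norm_nonneg[of \<Omega> h] by (simp add: t_def)
    have "t * L2_norm \<Omega> h < d"
      using d(1) L2_norm_nonneg[of \<Omega> h] by (simp add: t_def field_simps)
    then have "norm (S (\<lambda>x. u x + t *\<^sub>R h x) - S u - D (\<lambda>x. t *\<^sub>R h x)) \<le> e * (t * L2_norm \<Omega> h)"
      using d(2)[OF L2_space_scaleR[OF h, of t]] t by (simp add: L2_norm_scaleR)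
    moreover have "S (\<lambda>x. u x + t *\<^sub>R h x) - S u - D (\<lambda>x. t *\<^sub>R h x) = t *\<^sub>R (S h - D h)"
      using S lin u h L2_space_scaleR[OF h, of t] by (simp add: L2_linear_def algebra_simps)
    ultimately have "t * norm (S h - D h) \<le> t * (e * L2_norm \<Omega> h)"
      using t by (simp add: mult.left_commute)
    then show ?thesis using t by simp
  qed
  have "((\<lambda>e. e * L2_norm \<Omega> h) \<longlongrightarrow> 0 * L2_norm \<Omega> h) (at_right 0)"
    by (intro tendsto_intros)
  then have "norm (S h - D h) \<le> 0 * L2_norm \<Omega> h"
    by (rule tendsto_lowerbound)
      (use * in \<open>auto simp: eventually_at_right_less intro: eventually_mono[OF eventually_at_right_less]\<close>)
  then show ?thesis by simp
qed

text \<open>The distance of \<open>u x\<close> from \<open>M\<close> is at most the distance from \<open>us i x\<close>, so it vanishes in \<open>L\<^sup>2\<close>.\<close>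

lemma AE_in_closed_if_L2_limit:
  fixes u :: "'a::euclidean_space \<Rightarrow> 'b::euclidean_space"
  assumes u: "u \<in> L2_space \<Omega>" and us: "\<And>i. us i \<in> L2_space \<Omega>"
    and M: "closed M" "M \<noteq> {}" "\<And>i x. x \<in> space (lebesgue_on \<Omega>) \<Longrightarrow> us i x \<in> M"
    and lim: "(\<lambda>i. L2_norm \<Omega> (\<lambda>x. us i x - u x)) \<longlonglongrightarrow> 0"
  shows "AE x in lebesgue_on \<Omega>. u x \<in> M"
proof -
  let ?d = "\<lambda>x. (infdist (u x) M)\<^sup>2"
  have dist_meas: "(\<lambda>v. infdist v M) \<in> borel_measurable borel"
    using continuous_on_infdist[OF continuous_on_id, of UNIV M] by (rule borel_measurable_continuous_onI)
  have d_meas: "?d \<in> borel_measurable (lebesgue_on \<Omega>)"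
    by (intro borel_measurable_power measurable_compose[OF L2_space_measurable[OF u] dist_meas])
  have sq: "integrable (lebesgue_on \<Omega>) (\<lambda>x. (norm (us i x - u x))\<^sup>2)" for i
    by (intro L2_space_integrable_sq L2_space_diff us u)
  have d_le: "?d x \<le> (norm (us i x - u x))\<^sup>2" if "x \<in> space (lebesgue_on \<Omega>)" for i x
    using infdist_le[OF M(3)[OF that], of "u x" i]
    by (intro power_mono) (auto simp: dist_norm norm_minus_commute infdist_nonneg)
  have int: "integrable (lebesgue_on \<Omega>) ?d"
    using d_le by (intro Bochner_Integration.integrable_bound[OF sq[of 0] d_meas]) auto
  have le: "(\<integral>x. ?d x \<partial>lebesgue_on \<Omega>) \<le> (L2_norm \<Omega> (\<lambda>x. us i x - u x))\<^sup>2" for i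
    unfolding L2_norm_eq using integral_mono[OF int sq d_le, of i] by simp
  have "(\<lambda>i. (L2_norm \<Omega> (\<lambda>x. us i x - u x))\<^sup>2) \<longlonglongrightarrow> 0\<^sup>2"
    using lim by (intro tendsto_intros)
  then have "(\<integral>x. ?d x \<partial>lebesgue_on \<Omega>) \<le> 0\<^sup>2"
    by (rule LIMSEQ_le_const) (use le in auto)
  then have "(\<integral>x. ?d x \<partial>lebesgue_on \<Omega>) = 0"
    by (intro antisym Bochner_Integration.integral_nonneg) auto
  then have "AE x in lebesgue_on \<Omega>. ?d x = 0"
    by (subst (asm) integral_nonneg_eq_0_iff_AE[OF int]) auto
  then show ?thesis
    using in_closed_iff_infdist_zero[OF M(1,2)] by (auto elim: eventually_mono)
qed

section \<open>Minimizers and the optimality condition\<close>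

locale multibang_problem =
  finite_cost M a + divisible_measure "lebesgue_on \<Omega>"
  for M :: "'b::euclidean_space set" and a and \<Omega> :: "'a::euclidean_space set" +
  fixes S :: "('a \<Rightarrow> 'b) \<Rightarrow> 'y::real_inner" and g :: "'b \<Rightarrow> ereal"
  assumes g_envelope: "\<And>v. e2ennreal (g v) = envelope M a v"
    and S_bounded_linear: "L2_bounded_linear \<Omega> S"
    and S_compact: "L2_compact_map \<Omega> S"
    and S_adjoint: "\<And>y. \<exists>p. is_adjoint_value \<Omega> S y p"
begin

abbreviation "\<mu> \<equiv> lebesgue_on \<Omega>"

abbreviation "penalty u \<equiv> \<integral>\<^sup>+x. envelope M a (u x) \<partial>\<mu>"

lemma energy_eq: "energy \<Omega> S g z u = ennreal (1/2 * (norm (S u - z))\<^sup>2) + penalty u"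
  by (simp add: energy_def g_envelope)

lemma S_add: "u \<in> L2_space \<Omega> \<Longrightarrow> v \<in> L2_space \<Omega> \<Longrightarrow> S (\<lambda>x. u x + v x) = S u + S v"
  and S_scaleR: "u \<in> L2_space \<Omega> \<Longrightarrow> S (\<lambda>x. t *\<^sub>R u x) = t *\<^sub>R S u"
  using S_bounded_linear by (auto simp: L2_bounded_linear_def L2_linear_def)

lemma S_diff:
  assumes "u \<in> L2_space \<Omega>" "v \<in> L2_space \<Omega>"
  shows "S (\<lambda>x. u x - v x) = S u - S v"
  using S_add[OF assms(1) L2_space_scaleR[OF assms(2), of "-1"]] S_scaleR[OF assms(2), of "-1"] by simp

lemma envelope_measurable:
  assumes "u \<in> borel_measurable \<mu>"
  shows "(\<lambda>x. envelope M a (u x)) \<in> borel_measurable \<mu>"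
  using assms by measurable

lemma penalty_convex:
  assumes u: "u \<in> L2_space \<Omega>" and v: "v \<in> L2_space \<Omega>" and t: "0 \<le> t" "t \<le> 1"
  shows "penalty (\<lambda>x. (1 - t) *\<^sub>R u x + t *\<^sub>R v x) \<le> ennreal (1 - t) * penalty u + ennreal t * penalty v"
proof -
  have "penalty (\<lambda>x. (1 - t) *\<^sub>R u x + t *\<^sub>R v x)
      \<le> (\<integral>\<^sup>+x. ennreal (1 - t) * envelope M a (u x) + ennreal t * envelope M a (v x) \<partial>\<mu>)"
    using t by (intro nn_integral_mono envelope_convex)
  also have "\<dots> = ennreal (1 - t) * penalty u + ennreal t * penalty v"
    using envelope_measurable[OF L2_space_measurable[OF u]] envelope_measurable[OF L2_space_measurable[OF v]]
    by (simp add: nn_integral_add nn_integral_cmult)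
  finally show ?thesis .
qed

lemma penalty_finite_imp_bounded:
  assumes u: "u \<in> L2_space \<Omega>" and fin: "penalty u \<noteq> \<infinity>" and R: "\<And>w. w \<in> M \<Longrightarrow> norm w \<le> R"
  shows "AE x in \<mu>. norm (u x) \<le> R"
proof -
  have "AE x in \<mu>. envelope M a (u x) \<noteq> \<infinity>"
    using envelope_measurable[OF L2_space_measurable[OF u]] fin by (rule nn_integral_noteq_infinite)
  then show ?thesis
    by eventually_elim (use envelope_outside_ball[OF R] in force)
qed

lemma M_bounded: obtains R where "R > 0" "\<And>w. w \<in> M \<Longrightarrow> norm w \<le> R"
  using finite_imp_bounded[OF finite_M] unfolding bounded_pos by auto

lemma M_valued_in_L2:
  assumes "v \<in> borel_measurable \<mu>" "\<And>x. x \<in> space \<mu> \<Longrightarrow> v x \<in> M"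
  shows "v \<in> L2_space \<Omega>"
proof -
  obtain R where R: "\<And>w. w \<in> M \<Longrightarrow> norm w \<le> R" using M_bounded by metis
  show ?thesis
    using assms R by (intro L2_space_bounded[OF finite_measure_axioms, of v R]) auto
qed

lemma M_valued_penalty_le:
  assumes v: "v \<in> borel_measurable \<mu>" "\<And>x. x \<in> space \<mu> \<Longrightarrow> v x \<in> M"
  shows "integrable \<mu> (\<lambda>x. a (v x))" "penalty v \<le> ennreal (\<integral>x. a (v x) \<partial>\<mu>)"
proof -
  have "finite (v ` space \<mu>)" using v(2) finite_M by (auto intro: finite_subset[of _ M])
  then have "simple_function \<mu> v" using v(1) by (intro simple_function_borel_measurable)
  then have meas: "(\<lambda>x. a (v x)) \<in> borel_measurable \<mu>"
    using simple_function_compose[of \<mu> v a] by (auto simp: comp_def intro: borel_measurable_simple_function)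
  have "bounded (a ` M)" using finite_M by (simp add: finite_imp_bounded)
  then obtain B where B: "\<And>w. w \<in> M \<Longrightarrow> norm (a w) \<le> B" unfolding bounded_iff by auto
  show int: "integrable \<mu> (\<lambda>x. a (v x))"
    using meas v(2) B by (intro integrable_const_bound[of _ B]) auto
  have "penalty v \<le> (\<integral>\<^sup>+x. ennreal (a (v x)) \<partial>\<mu>)"
    using v(2) envelope_le_cost by (intro nn_integral_mono) auto
  also have "\<dots> = ennreal (\<integral>x. a (v x) \<partial>\<mu>)"
    using int v(2) cost_nonneg by (intro nn_integral_eq_integral) auto
  finally show "penalty v \<le> ennreal (\<integral>x. a (v x) \<partial>\<mu>)" .
qed

lemma M_valued_energy_finite:
  assumes "v \<in> borel_measurable \<mu>" "\<And>x. x \<in> space \<mu> \<Longrightarrow> v x \<in> M"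
  shows "energy \<Omega> S g z v \<noteq> \<infinity>"
  using M_valued_penalty_le(2)[OF assms] by (auto simp: energy_eq top_unique)

text \<open>The sublevel sets just above the infimum are midpoint convex and bounded, hence their
  near-minimal-norm elements converge strongly. The data term passes to the limit because \<open>S\<close> is
  bounded, the penalty by Fatou's lemma and the lower semicontinuity of the envelope.\<close>

lemma minimizer_exists: "\<exists>u. is_minimizer \<Omega> S g z u"
proof -
  obtain R where R: "\<And>w. w \<in> M \<Longrightarrow> norm w \<le> R" using M_bounded by metis
  define I where "I = (INF u\<in>L2_space \<Omega>. energy \<Omega> S g z u)"
  obtain m where m: "m \<in> M" using M_nonempty by auto
  have "(\<lambda>_. m) \<in> L2_space \<Omega>" using m by (intro M_valued_in_L2) auto
  then have "I \<le> energy \<Omega> S g z (\<lambda>_. m)" unfolding I_def by (rule INF_lower)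
  then have "I \<noteq> \<infinity>" using M_valued_energy_finite[of "\<lambda>_. m" z] m by (auto simp: top_unique)
  then obtain i where i: "I = ennreal i" "i \<ge> 0" by (cases I) auto
  define c where "c n = i + 1 / real (Suc n)" for n
  have c0: "c n \<ge> 0" for n using i(2) by (simp add: c_def)
  define K where "K n = {u\<in>L2_space \<Omega>. energy \<Omega> S g z u \<le> ennreal (c n)}" for n
  have K_real: "\<exists>j\<ge>0. penalty u = ennreal j \<and> 1/2 * (norm (S u - z))\<^sup>2 + j \<le> c n" if "u \<in> K n" for u n
  proof -
    have *: "ennreal (1/2 * (norm (S u - z))\<^sup>2) + penalty u \<le> ennreal (c n)"
      using that by (simp add: K_def energy_eq)
    then have "penalty u \<noteq> \<infinity>" by (auto simp: top_unique)
    then obtain j where j: "penalty u = ennreal j" "j \<ge> 0" by (cases "penalty u") auto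
    then have "ennreal (1/2 * (norm (S u - z))\<^sup>2 + j) \<le> ennreal (c n)"
      using * by (subst ennreal_plus) auto
    then have "1/2 * (norm (S u - z))\<^sup>2 + j \<le> c n"
      using c0[of n] by (simp only: ennreal_le_iff)
    then show ?thesis using j by auto
  qed
  have "\<exists>w u. w \<in> L2_space \<Omega> \<and> (\<forall>n. u n \<in> K n) \<and>
    (AE x in \<mu>. (\<lambda>n. u n x) \<longlonglongrightarrow> w x) \<and> (\<lambda>n. L2_norm \<Omega> (\<lambda>x. u n x - w x)) \<longlonglongrightarrow> 0"
  proof (rule nested_midpoint_convex_limit[OF finite_measure_axioms, of K R])
    show "decseq K"
      unfolding decseq_def K_def c_def
      by (auto elim!: order_trans intro!: ennreal_leI add_left_mono divide_left_mono)
    show "K n \<noteq> {}" for n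
    proof -
      have "I < ennreal (c n)" using i by (simp add: c_def ennreal_less_iff)
      then obtain u where "u \<in> L2_space \<Omega>" "energy \<Omega> S g z u < ennreal (c n)"
        unfolding I_def by (auto simp: INF_less_iff)
      then show ?thesis by (auto simp: K_def intro: less_imp_le)
    qed
    show "K n \<subseteq> L2_space \<Omega>" for n by (auto simp: K_def)
    show "AE x in \<mu>. norm (u x) \<le> R" if "u \<in> K n" for n u
      using that K_real[OF that] R by (intro penalty_finite_imp_bounded) (auto simp: K_def)
    show "(\<lambda>x. (1/2) *\<^sub>R u x + (1/2) *\<^sub>R v x) \<in> K n" if u: "u \<in> K n" and v: "v \<in> K n" for n u v
    proof -
      let ?m = "\<lambda>x. (1/2) *\<^sub>R u x + (1/2) *\<^sub>R v x"
      have L2: "u \<in> L2_space \<Omega>" "v \<in> L2_space \<Omega>" using u v by (auto simp: K_def)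
      obtain j where j: "j \<ge> 0" "penalty u = ennreal j" "1/2 * (norm (S u - z))\<^sup>2 + j \<le> c n"
        using K_real[OF u] by auto
      obtain k where k: "k \<ge> 0" "penalty v = ennreal k" "1/2 * (norm (S v - z))\<^sup>2 + k \<le> c n"
        using K_real[OF v] by auto
      have half: "ennreal (1/2) * ennreal r = ennreal (1/2 * r)" for r
        by (rule ennreal_mult'[symmetric]) simp
      have "penalty ?m \<le> ennreal (1/2) * ennreal j + ennreal (1/2) * ennreal k"
        using penalty_convex[OF L2, of "1/2"] j k by simp
      also have "\<dots> = ennreal (1/2 * j) + ennreal (1/2 * k)"
        unfolding half ..
      also have "\<dots> = ennreal (1/2 * j + 1/2 * k)"
        using j k by (subst ennreal_plus) auto
      finally have pm: "penalty ?m \<le> ennreal (1/2 * j + 1/2 * k)" .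
      have "S ?m - z = (1/2) *\<^sub>R (S u - z) + (1/2) *\<^sub>R (S v - z)"
        using L2 by (simp add: S_add S_scaleR L2_space_scaleR algebra_simps flip: scaleR_add_left)
      then have "(norm (S ?m - z))\<^sup>2 \<le> 2 * (norm ((1/2) *\<^sub>R (S u - z)))\<^sup>2 + 2 * (norm ((1/2) *\<^sub>R (S v - z)))\<^sup>2"
        by (simp only: norm_add_sq_le)
      then have "1/2 * (norm (S ?m - z))\<^sup>2 \<le> 1/2 * (1/2 * (norm (S u - z))\<^sup>2) + 1/2 * (1/2 * (norm (S v - z))\<^sup>2)"
        by (simp add: power_divide)
      then have "1/2 * (norm (S ?m - z))\<^sup>2 + (1/2 * j + 1/2 * k) \<le> c n"
        using j(3) k(3) by argo
      then have "ennreal (1/2 * (norm (S ?m - z))\<^sup>2 + (1/2 * j + 1/2 * k)) \<le> ennreal (c n)"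
        by (rule ennreal_leI)
      moreover have "ennreal (1/2 * (norm (S ?m - z))\<^sup>2 + (1/2 * j + 1/2 * k)) =
          ennreal (1/2 * (norm (S ?m - z))\<^sup>2) + ennreal (1/2 * j + 1/2 * k)"
        using j k by (intro ennreal_plus) auto
      ultimately have "ennreal (1/2 * (norm (S ?m - z))\<^sup>2) + ennreal (1/2 * j + 1/2 * k) \<le> ennreal (c n)"
        by (simp only:)
      then have "energy \<Omega> S g z ?m \<le> ennreal (c n)"
        unfolding energy_eq using pm by (meson add_left_mono order_trans)
      then show ?thesis using L2 by (simp add: K_def L2_space_add L2_space_scaleR)
    qed
  qed blast
  then obtain w u where w: "w \<in> L2_space \<Omega>" and u: "\<And>n. u n \<in> K n"
    and ae: "AE x in \<mu>. (\<lambda>n. u n x) \<longlonglongrightarrow> w x"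
    and lim: "(\<lambda>n. L2_norm \<Omega> (\<lambda>x. u n x - w x)) \<longlonglongrightarrow> 0"
    by blast
  have uL2: "u n \<in> L2_space \<Omega>" for n using u by (auto simp: K_def)
  obtain C where C: "\<And>u. u \<in> L2_space \<Omega> \<Longrightarrow> norm (S u) \<le> C * L2_norm \<Omega> u"
    using S_bounded_linear by (auto simp: L2_bounded_linear_def)
  have "(\<lambda>n. S (u n) - S w) \<longlonglongrightarrow> 0"
  proof (rule Lim_null_comparison)
    show "\<forall>\<^sub>F n in sequentially. norm (S (u n) - S w) \<le> C * L2_norm \<Omega> (\<lambda>x. u n x - w x)"
      using C[OF L2_space_diff[OF uL2 w]] by (simp add: S_diff uL2 w)
    show "(\<lambda>n. C * L2_norm \<Omega> (\<lambda>x. u n x - w x)) \<longlonglongrightarrow> 0"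
      using tendsto_mult_right_zero[OF lim] by simp
  qed
  then have Su: "(\<lambda>n. S (u n)) \<longlonglongrightarrow> S w" by (rule LIM_zero_cancel)
  have "(\<lambda>n. i + inverse (real (Suc n))) \<longlonglongrightarrow> i + 0"
    by (intro tendsto_intros LIMSEQ_inverse_real_of_nat)
  then have c: "c \<longlonglongrightarrow> i" by (simp add: c_def[abs_def] inverse_eq_divide)
  let ?q = "1/2 * (norm (S w - z))\<^sup>2"
  \<comment> \<open>\<open>b n\<close> bounds the penalty of \<open>u n\<close>: what the level \<open>c n\<close> leaves after the data term.\<close>
  define b where "b n = c n - 1/2 * (norm (S (u n) - z))\<^sup>2" for n
  have b: "b \<longlonglongrightarrow> i - ?q"
    unfolding b_def using Su c by (intro tendsto_intros)
  have pb: "penalty (u n) \<le> ennreal (b n)" and b0: "0 \<le> b n" for n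
    using K_real[OF u[of n]] by (auto simp: b_def ennreal_leI)
  have q: "0 \<le> i - ?q" using b b0 by (intro LIMSEQ_le_const) auto
  have "penalty w \<le> (\<integral>\<^sup>+x. liminf (\<lambda>n. envelope M a (u n x)) \<partial>\<mu>)"
    using ae by (intro nn_integral_mono_AE) (auto elim!: eventually_mono intro: envelope_le_liminf)
  also have "\<dots> \<le> liminf (\<lambda>n. penalty (u n))"
    using uL2 by (intro nn_integral_liminf envelope_measurable L2_space_measurable)
  also have "\<dots> \<le> liminf (\<lambda>n. ennreal (b n))"
    using pb by (intro Liminf_mono) auto
  also have "\<dots> = ennreal (i - ?q)"
    using b by (intro lim_imp_Liminf tendsto_ennrealI) auto
  finally have "energy \<Omega> S g z w \<le> ennreal ?q + ennreal (i - ?q)"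
    unfolding energy_eq by (intro add_left_mono)
  also have "\<dots> = I" using q i by (subst ennreal_plus[symmetric]) auto
  finally have "energy \<Omega> S g z w \<le> I" .
  then have "is_minimizer \<Omega> S g z w"
    unfolding is_minimizer_def using w by (auto simp: I_def intro: INF_lower order_trans)
  then show ?thesis by blast
qed

lemma contact_measurable:
  assumes "p \<in> borel_measurable \<mu>"
  shows "(\<lambda>x. contact_set M a (p x)) \<in> measurable \<mu> (count_space (Pow M))"
  using measurable_compose[OF assms contact_set_measurable] .

text \<open>Sufficiency of the optimality condition: on the contact set the cost attains the affine
  minorant with slope \<open>p x\<close>, so \<open>p\<close> is a subgradient of the penalty at \<open>v\<close>, and minus the gradient
  of the data term.\<close>

lemma is_minimizer_if_contact:
  assumes v: "v \<in> L2_space \<Omega>" and p: "is_adjoint_value \<Omega> S (z - S v) p"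
    and contact: "\<And>x. x \<in> space \<mu> \<Longrightarrow> v x \<in> contact_set M a (p x)"
  shows "is_minimizer \<Omega> S g z v"
  unfolding is_minimizer_def
proof (intro conjI ballI v)
  fix u :: "'a \<Rightarrow> 'b" assume u: "u \<in> L2_space \<Omega>"
  let ?H = "\<lambda>x. p x \<bullet> v x - a (v x)"
  have pL2: "p \<in> L2_space \<Omega>" using p by (simp add: is_adjoint_value_def)
  have vM: "v x \<in> M" if "x \<in> space \<mu>" for x using contact[OF that] contact_set_subset by blast
  note av = M_valued_penalty_le[OF L2_space_measurable[OF v] vM]
  have av0: "0 \<le> (\<integral>x. a (v x) \<partial>\<mu>)"
    using vM cost_nonneg by (intro Bochner_Integration.integral_nonneg) auto
  have H: "?H x = cost_conj M a (p x)" if "x \<in> space \<mu>" for x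
    using contact[OF that] by (simp add: contact_set_def)
  show "energy \<Omega> S g z v \<le> energy \<Omega> S g z u"
  proof (cases "penalty u = \<infinity>")
    case True
    then show ?thesis by (simp add: energy_eq)
  next
    case False
    then obtain j where j: "penalty u = ennreal j" "j \<ge> 0" by (cases "penalty u") auto
    have int: "integrable \<mu> (\<lambda>x. p x \<bullet> u x - ?H x)"
      using av(1) L2_space_integrable_inner[OF pL2 u] L2_space_integrable_inner[OF pL2 v] by simp
    have "ennreal (\<integral>x. p x \<bullet> u x - ?H x \<partial>\<mu>) \<le> (\<integral>\<^sup>+x. ennreal (p x \<bullet> u x - ?H x) \<partial>\<mu>)"
    proof -
      have "ennreal (\<integral>x. p x \<bullet> u x - ?H x \<partial>\<mu>) \<le> ennreal (\<integral>x. max 0 (p x \<bullet> u x - ?H x) \<partial>\<mu>)"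
        using int by (intro ennreal_leI integral_mono) auto
      also have "\<dots> = (\<integral>\<^sup>+x. ennreal (max 0 (p x \<bullet> u x - ?H x)) \<partial>\<mu>)"
        using int by (intro nn_integral_eq_integral[symmetric]) auto
      also have "\<dots> = (\<integral>\<^sup>+x. ennreal (p x \<bullet> u x - ?H x) \<partial>\<mu>)"
        by (intro nn_integral_cong) (simp add: max_def ennreal_neg)
      finally show ?thesis .
    qed
    also have "\<dots> \<le> penalty u"
      using envelope_lower by (intro nn_integral_mono) (simp add: H)
    finally have "(\<integral>x. p x \<bullet> u x - ?H x \<partial>\<mu>) \<le> j"
      using j by (simp add: ennreal_le_iff)
    moreover have "(\<integral>x. p x \<bullet> u x - ?H x \<partial>\<mu>) = L2_inner \<Omega> p u - L2_inner \<Omega> p v + (\<integral>x. a (v x) \<partial>\<mu>)"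
      using av(1) L2_space_integrable_inner[OF pL2 u] L2_space_integrable_inner[OF pL2 v]
      by (simp add: L2_inner_def)
    ultimately have "(z - S v) \<bullet> (S u - S v) + (\<integral>x. a (v x) \<partial>\<mu>) \<le> j"
      using p u v by (simp add: is_adjoint_value_def inner_diff_right)
    moreover have "(norm (S u - z))\<^sup>2 = (norm (S v - z))\<^sup>2 + (norm (S u - S v))\<^sup>2 - 2 * ((z - S v) \<bullet> (S u - S v))"
      unfolding power2_norm_eq_inner by (simp add: inner_diff_left inner_diff_right inner_commute)
    moreover have "0 \<le> (norm (S u - S v))\<^sup>2" by simp
    ultimately have le: "1/2 * (norm (S v - z))\<^sup>2 + (\<integral>x. a (v x) \<partial>\<mu>) \<le> 1/2 * (norm (S u - z))\<^sup>2 + j"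
      by argo
    have "energy \<Omega> S g z v \<le> ennreal (1/2 * (norm (S v - z))\<^sup>2) + ennreal (\<integral>x. a (v x) \<partial>\<mu>)"
      unfolding energy_eq by (intro add_left_mono av(2))
    also have "\<dots> = ennreal (1/2 * (norm (S v - z))\<^sup>2 + (\<integral>x. a (v x) \<partial>\<mu>))"
      using av0 by (subst ennreal_plus) auto
    also have "\<dots> \<le> ennreal (1/2 * (norm (S u - z))\<^sup>2 + j)"
      by (rule ennreal_leI[OF le])
    also have "\<dots> = energy \<Omega> S g z u"
      using j unfolding energy_eq by (subst ennreal_plus) auto
    finally show ?thesis .
  qed
qed

text \<open>Necessity of the optimality condition, by a variation towards a measurable selection \<open>v\<close> of the
  contact sets of \<open>p\<close>. As \<open>v\<close> realises the conjugate pointwise, the first-order inequality says that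
  the Fenchel gap of \<open>u\<close> has non-positive integral; the gap is non-negative, so it vanishes almost
  everywhere.\<close>

lemma minimizer_in_hull_contact:
  assumes u: "is_minimizer \<Omega> S g z u" and p: "is_adjoint_value \<Omega> S (z - S u) p"
  shows "AE x in \<mu>. u x \<in> convex hull contact_set M a (p x)"
proof -
  have uL2: "u \<in> L2_space \<Omega>" using u by (simp add: is_minimizer_def)
  have pL2: "p \<in> L2_space \<Omega>" using p by (simp add: is_adjoint_value_def)
  define v where "v x = (SOME w. w \<in> contact_set M a (p x))" for x
  have v: "v x \<in> contact_set M a (p x)" for x
    unfolding v_def using contact_set_nonempty[of "p x"] by (simp add: some_in_eq)
  then have vM: "v x \<in> M" for x using contact_set_subset by blast
  have v_meas: "v \<in> borel_measurable \<mu>"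
    unfolding v_def by (rule measurable_compose[OF contact_measurable[OF L2_space_measurable[OF pL2]]]) simp
  have vL2: "v \<in> L2_space \<Omega>" using v_meas vM by (rule M_valued_in_L2)
  note av = M_valued_penalty_le[OF v_meas vM]
  have "energy \<Omega> S g z u \<le> energy \<Omega> S g z v"
    using u vL2 by (simp add: is_minimizer_def)
  then have "penalty u \<noteq> \<infinity>" "penalty v \<noteq> \<infinity>"
    using M_valued_energy_finite[OF v_meas vM, of z] by (auto simp: energy_eq top_unique)
  then obtain j k where j: "penalty u = ennreal j" "j \<ge> 0" and k: "penalty v = ennreal k" "k \<ge> 0"
    by (cases "penalty u"; cases "penalty v") auto
  have k_le: "k \<le> (\<integral>x. a (v x) \<partial>\<mu>)"
    using av(2) k vM cost_nonneg by (simp add: ennreal_le_iff Bochner_Integration.integral_nonneg)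
  define D where "D = S v - S u"
  have var: "(z - S u) \<bullet> D \<le> k - j + t / 2 * (norm D)\<^sup>2" if t: "0 < t" "t < 1" for t
  proof -
    let ?w = "\<lambda>x. (1 - t) *\<^sub>R u x + t *\<^sub>R v x"
    have "S ?w = (1 - t) *\<^sub>R S u + t *\<^sub>R S v"
      using uL2 vL2 by (simp only: S_add S_scaleR L2_space_scaleR)
    then have Sw: "S ?w - z = (S u - z) + t *\<^sub>R D"
      by (simp add: D_def algebra_simps)
    have "penalty ?w \<le> ennreal (1 - t) * ennreal j + ennreal t * ennreal k"
      using penalty_convex[OF uL2 vL2, of t] t j k by simp
    also have "\<dots> = ennreal ((1 - t) * j + t * k)"
      using t j k by (subst ennreal_plus) (auto simp: ennreal_mult)
    finally have pw: "penalty ?w \<le> ennreal ((1 - t) * j + t * k)" .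
    have "ennreal (1/2 * (norm (S u - z))\<^sup>2 + j) = energy \<Omega> S g z u"
      unfolding energy_eq using j by (subst ennreal_plus) auto
    also have "\<dots> \<le> energy \<Omega> S g z ?w"
      using u uL2 vL2 by (simp add: is_minimizer_def L2_space_add L2_space_scaleR)
    also have "\<dots> \<le> ennreal (1/2 * (norm (S ?w - z))\<^sup>2) + ennreal ((1 - t) * j + t * k)"
      unfolding energy_eq by (intro add_left_mono pw)
    also have "\<dots> = ennreal (1/2 * (norm (S ?w - z))\<^sup>2 + ((1 - t) * j + t * k))"
      using t j k by (subst ennreal_plus) auto
    finally have "1/2 * (norm (S u - z))\<^sup>2 + j \<le> 1/2 * (norm (S ?w - z))\<^sup>2 + ((1 - t) * j + t * k)"
      using t j k by (subst (asm) ennreal_le_iff) auto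
    moreover have "(norm (S ?w - z))\<^sup>2 = (norm (S u - z))\<^sup>2 - 2 * t * ((z - S u) \<bullet> D) + t * t * (norm D)\<^sup>2"
      unfolding Sw power2_norm_eq_inner
      by (simp add: inner_add_left inner_add_right inner_diff_left inner_diff_right inner_commute algebra_simps)
    ultimately have "t * ((z - S u) \<bullet> D) \<le> t * (k - j + t / 2 * (norm D)\<^sup>2)"
      by (simp add: algebra_simps)
    then show ?thesis using t by simp
  qed
  have "((\<lambda>t. k - j + t / 2 * (norm D)\<^sup>2) \<longlongrightarrow> k - j + 0 / 2 * (norm D)\<^sup>2) (at_right 0)"
    by (intro tendsto_intros) auto
  moreover have "\<forall>\<^sub>F t in at_right (0::real). (z - S u) \<bullet> D \<le> k - j + t / 2 * (norm D)\<^sup>2"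
    using var by (auto simp: eventually_at_right_field intro!: exI[of _ 1])
  ultimately have "(z - S u) \<bullet> D \<le> k - j + 0 / 2 * (norm D)\<^sup>2"
    by (intro tendsto_lowerbound) auto
  then have first_order: "L2_inner \<Omega> p v - L2_inner \<Omega> p u \<le> k - j"
    using p uL2 vL2 by (simp add: is_adjoint_value_def D_def inner_diff_right)
  define e where "e x = enn2real (envelope M a (u x))" for x
  have env_meas: "(\<lambda>x. envelope M a (u x)) \<in> borel_measurable \<mu>"
    using uL2 by (intro envelope_measurable L2_space_measurable)
  have "AE x in \<mu>. envelope M a (u x) \<noteq> \<infinity>"
    using env_meas j by (intro nn_integral_noteq_infinite) auto
  then have e_eq: "AE x in \<mu>. envelope M a (u x) = ennreal (e x)"
    by eventually_elim (simp add: e_def less_top)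
  have e_meas: "e \<in> borel_measurable \<mu>"
    unfolding e_def using env_meas by measurable
  have pen_e: "(\<integral>\<^sup>+x. ennreal (e x) \<partial>\<mu>) = ennreal j"
    using e_eq j(1) by (subst nn_integral_cong_AE[of _ "\<lambda>x. envelope M a (u x)"]) (auto elim: eventually_mono)
  then have int_e: "integrable \<mu> e"
    using e_meas by (intro integrableI_nonneg) (auto simp: e_def)
  have j_eq: "(\<integral>x. e x \<partial>\<mu>) = j"
    using pen_e e_meas j(2) by (subst integral_eq_nn_integral) (auto simp: e_def)
  \<comment> \<open>The Fenchel gap at \<open>(u x, p x)\<close>, with the conjugate written through \<open>v\<close> as in \<open>H\<close> below.\<close>
  let ?r = "\<lambda>x. e x + (p x \<bullet> v x - a (v x)) - p x \<bullet> u x"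
  have H: "p x \<bullet> v x - a (v x) = cost_conj M a (p x)" for x
    using v[of x] by (simp add: contact_set_def)
  have r0: "AE x in \<mu>. 0 \<le> ?r x"
    using e_eq
  proof eventually_elim
    case (elim x)
    have "0 \<le> e x" by (simp add: e_def)
    then show ?case
      using envelope_lower[of "p x" "u x"] unfolding elim H by (simp add: ennreal_le_iff)
  qed
  note ints = int_e av(1) L2_space_integrable_inner[OF pL2 vL2] L2_space_integrable_inner[OF pL2 uL2]
  have int_r: "integrable \<mu> ?r" using ints by simp
  have "(\<integral>x. ?r x \<partial>\<mu>) = j + L2_inner \<Omega> p v - (\<integral>x. a (v x) \<partial>\<mu>) - L2_inner \<Omega> p u"
    using ints by (simp add: L2_inner_def j_eq)
  then have "(\<integral>x. ?r x \<partial>\<mu>) \<le> 0" using first_order k_le by linarith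
  moreover have "0 \<le> (\<integral>x. ?r x \<partial>\<mu>)" using r0 by (rule integral_nonneg_AE)
  ultimately have "AE x in \<mu>. ?r x = 0"
    using integral_nonneg_eq_0_iff_AE[OF int_r r0] by simp
  then show ?thesis
    using e_eq
  proof eventually_elim
    case (elim x)
    then have eq: "p x \<bullet> u x - cost_conj M a (p x) = e x" using H[of x] by simp
    have "0 \<le> e x" by (simp add: e_def)
    then show ?case
      using elim(2) by (intro mem_convex_hull_contact_set) (simp_all only: eq order_refl)
  qed
qed

text \<open>Compactness of \<open>S\<close> turns weak closeness into closeness in norm: the candidates for \<open>S v - S u\<close>
  lie in a totally bounded set, so it is enough to make \<open>S v - S u\<close> nearly orthogonal to the centres
  of a finite net, and the adjoint turns each of these conditions into a pairing of \<open>v - u\<close> with a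
  fixed function.\<close>

lemma contact_selection_close:
  assumes u: "u \<in> L2_space \<Omega>" and p: "p \<in> borel_measurable \<mu>"
    and hull: "AE x in \<mu>. u x \<in> convex hull contact_set M a (p x)" and \<epsilon>: "\<epsilon> > 0"
  obtains v where "v \<in> L2_space \<Omega>" "\<And>x. x \<in> space \<mu> \<Longrightarrow> v x \<in> contact_set M a (p x)"
    "norm (S v - S u) < \<epsilon>"
proof -
  obtain R where R: "R > 0" "\<And>w. w \<in> M \<Longrightarrow> norm w \<le> R" using M_bounded by metis
  define B :: "('a \<Rightarrow> 'b) set" where "B = {h\<in>L2_space \<Omega>. AE x in \<mu>. norm (h x) \<le> 2 * R}"
  have B_norm: "L2_norm \<Omega> h \<le> sqrt ((2 * R)\<^sup>2 * measure \<mu> (space \<mu>))" if "h \<in> B" for h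
  proof -
    have "(\<integral>x. (norm (h x))\<^sup>2 \<partial>\<mu>) \<le> (\<integral>x. (2 * R)\<^sup>2 \<partial>\<mu>)"
    proof (rule integral_mono_AE)
      show "integrable \<mu> (\<lambda>x. (norm (h x))\<^sup>2)"
        using that by (auto simp: B_def intro: L2_space_integrable_sq)
      have "AE x in \<mu>. norm (h x) \<le> 2 * R" using that by (simp add: B_def)
      then show "AE x in \<mu>. (norm (h x))\<^sup>2 \<le> (2 * R)\<^sup>2"
        by eventually_elim (rule power_mono, auto)
    qed simp
    then show ?thesis unfolding L2_norm_eq by (intro real_sqrt_le_mono) (simp add: mult_ac)
  qed
  have "B \<subseteq> L2_space \<Omega>" by (auto simp: B_def)
  moreover have "\<exists>r. \<forall>h\<in>B. L2_norm \<Omega> h \<le> r" using B_norm by blast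
  ultimately have "compact (closure (S ` B))"
    by (rule S_compact[unfolded L2_compact_map_def, rule_format])
  then obtain N where N: "finite N" "closure (S ` B) \<subseteq> (\<Union>y\<in>N. ball y (\<epsilon> / 2))"
    using \<epsilon> half_gt_zero unfolding compact_eq_totally_bounded by metis
  obtain q where q: "\<And>y. is_adjoint_value \<Omega> S y (q y)" using S_adjoint by metis
  have K: "{x \<in> space \<mu>. contact_set M a (p x) = A} \<in> sets \<mu>" for A
  proof (cases "A \<subseteq> M")
    case True
    then show ?thesis
      using measurable_sets[OF contact_measurable[OF p], of "{A}"]
      by (simp add: vimage_def Int_def conj_commute)
  next
    case False
    then have empty: "{x \<in> space \<mu>. contact_set M a (p x) = A} = {}" using contact_set_subset by blast
    show ?thesis unfolding empty by (rule sets.empty_sets)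
  qed
  have "\<exists>v\<in>borel_measurable \<mu>. (\<forall>x\<in>space \<mu>. v x \<in> contact_set M a (p x)) \<and>
      (\<forall>f\<in>q ` N. \<bar>\<integral>x. (v x - u x) \<bullet> f x \<partial>\<mu>\<bar> < \<epsilon>\<^sup>2 / 2)"
  proof (rule finite_selection_weakly_close[OF _ _ finite_M contact_set_subset contact_set_nonempty K])
    show "integrable \<mu> f" if "f \<in> q ` N" for f
      using that q by (auto simp: is_adjoint_value_def intro!: L2_space_integrable[OF finite_measure_axioms])
  qed (use N(1) u hull \<epsilon> in \<open>auto intro: L2_space_measurable\<close>)
  then obtain v where v: "v \<in> borel_measurable \<mu>" "\<And>x. x \<in> space \<mu> \<Longrightarrow> v x \<in> contact_set M a (p x)"
    "\<And>y. y \<in> N \<Longrightarrow> \<bar>\<integral>x. (v x - u x) \<bullet> q y x \<partial>\<mu>\<bar> < \<epsilon>\<^sup>2 / 2"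
    by auto
  have vM: "v x \<in> M" if "x \<in> space \<mu>" for x using v(2)[OF that] contact_set_subset by blast
  have vL2: "v \<in> L2_space \<Omega>" using v(1) vM by (rule M_valued_in_L2)
  have diff: "(\<lambda>x. v x - u x) \<in> L2_space \<Omega>" using vL2 u by (rule L2_space_diff)
  have "AE x in \<mu>. norm (v x - u x) \<le> 2 * R"
    using hull AE_space
  proof eventually_elim
    case (elim x)
    have "convex hull contact_set M a (p x) \<subseteq> cball 0 R"
      using contact_set_subset[of "p x"] R by (intro hull_minimal) auto
    then have "norm (u x) \<le> R" using elim by auto
    moreover have "norm (v x) \<le> R" using R(2) vM elim by simp
    ultimately show ?case using norm_triangle_ineq4[of "v x" "u x"] by linarith
  qed
  then have "(\<lambda>x. v x - u x) \<in> B" using diff by (simp add: B_def)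
  then have "S (\<lambda>x. v x - u x) \<in> closure (S ` B)"
    by (intro subsetD[OF closure_subset] imageI)
  moreover define w where "w = S v - S u"
  ultimately have "w \<in> closure (S ` B)" using S_diff[OF vL2 u] by simp
  then obtain y where y: "y \<in> N" "norm (w - y) < \<epsilon> / 2"
    using N(2) by (auto simp: dist_norm norm_minus_commute)
  have "y \<bullet> w = L2_inner \<Omega> (q y) (\<lambda>x. v x - u x)"
    using q[of y] diff S_diff[OF vL2 u] by (simp add: is_adjoint_value_def w_def)
  also have "\<dots> = (\<integral>x. (v x - u x) \<bullet> q y x \<partial>\<mu>)"
    unfolding L2_inner_def by (intro Bochner_Integration.integral_cong refl inner_commute)
  finally have "y \<bullet> w = (\<integral>x. (v x - u x) \<bullet> q y x \<partial>\<mu>)" .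
  then have yw: "y \<bullet> w < \<epsilon>\<^sup>2 / 2" using v(3)[OF y(1)] by linarith
  \<comment> \<open>Split \<open>w \<bullet> w\<close> at the centre \<open>y\<close>: the net absorbs one half of it, near orthogonality the other.\<close>
  have "norm w < \<epsilon>"
  proof (rule ccontr)
    assume "\<not> norm w < \<epsilon>"
    then have ge: "\<epsilon> \<le> norm w" by simp
    have "(norm w)\<^sup>2 = y \<bullet> w + (w - y) \<bullet> w"
      by (simp add: power2_norm_eq_inner inner_diff_left)
    also have "(w - y) \<bullet> w \<le> norm (w - y) * norm w" by (rule norm_cauchy_schwarz)
    also have "\<dots> \<le> \<epsilon> / 2 * norm w" using y(2) by (intro mult_right_mono) auto
    also have "\<dots> \<le> norm w / 2 * norm w" using ge by (intro mult_right_mono) auto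
    finally have "(norm w)\<^sup>2 < \<epsilon>\<^sup>2 / 2 + (norm w)\<^sup>2 / 2"
      using yw by (simp add: power2_eq_square)
    moreover have "\<epsilon>\<^sup>2 \<le> (norm w)\<^sup>2" using ge \<epsilon> by (intro power_mono) auto
    ultimately show False by linarith
  qed
  then show ?thesis using that[OF vL2 v(2)] by (simp add: w_def)
qed

text \<open>Moving the target by \<open>S v - S u\<close> leaves the residual \<open>z - S u\<close>, hence the dual variable \<open>p\<close>,
  unchanged. The rounded control \<open>v\<close> satisfies the optimality condition for the same \<open>p\<close>.\<close>

lemma multibang_minimizer_nearby:
  assumes u: "is_minimizer \<Omega> S g z u" and \<epsilon>: "\<epsilon> > 0"
  obtains z' v where "dist z' z < \<epsilon>" "is_minimizer \<Omega> S g z' v" "\<And>x. x \<in> space \<mu> \<Longrightarrow> v x \<in> M"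
proof -
  obtain p where p: "is_adjoint_value \<Omega> S (z - S u) p" using S_adjoint by metis
  have uL2: "u \<in> L2_space \<Omega>" using u by (simp add: is_minimizer_def)
  have "p \<in> borel_measurable \<mu>" using p by (auto simp: is_adjoint_value_def intro: L2_space_measurable)
  then obtain v where v: "v \<in> L2_space \<Omega>" "\<And>x. x \<in> space \<mu> \<Longrightarrow> v x \<in> contact_set M a (p x)"
    "norm (S v - S u) < \<epsilon>"
    using contact_selection_close[OF uL2 _ minimizer_in_hull_contact[OF u p] \<epsilon>] by metis
  have "is_minimizer \<Omega> S g (z - S u + S v) v"
    using v p by (intro is_minimizer_if_contact) auto
  moreover have "dist (z - S u + S v) z < \<epsilon>"
    using v(3) by (simp add: dist_norm)
  moreover have "v x \<in> M" if "x \<in> space \<mu>" for x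
    using v(2)[OF that] contact_set_subset by blast
  ultimately show ?thesis using that by blast
qed

end

section \<open>Density of multibang targets and instability of singular arcs\<close>

theorem corollary3p7:
  fixes \<Omega> :: "(real ^ 'n) set"
    and M :: "(real ^ 'm) set"
    and \<alpha> :: real
    and c :: "real ^ 'm \<Rightarrow> real"
    and g :: "real ^ 'm \<Rightarrow> ereal"
    and S :: "(real ^ 'n \<Rightarrow> real ^ 'm) \<Rightarrow> 'y::{real_inner, complete_space}"
    and S' :: "(real ^ 'n \<Rightarrow> real ^ 'm) \<Rightarrow> (real ^ 'n \<Rightarrow> real ^ 'm) \<Rightarrow> 'y"
    and \<iota> :: "(real ^ 'n \<Rightarrow> real ^ 'm) \<Rightarrow> 'v::banach"
    and \<kappa> :: "('v \<Rightarrow>\<^sub>L real) \<Rightarrow> real ^ 'n \<Rightarrow> real ^ 'm"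
  assumes "open \<Omega>" and "bounded \<Omega>" and "\<Omega> \<noteq> {}"
    and "CARD('m) \<ge> 2"
    and "finite M" and "M \<noteq> {}"
    and "\<alpha> > 0"
    and "\<And>v. c v \<ge> 0" and "strictly_convex c" and "lower_semicont c"
    and g: "g = multibang_penalty \<alpha> c M"
    and S: "L2_well_defined \<Omega> S"
    and weak: "\<And>us u. L2_weak_conv \<Omega> us u \<Longrightarrow> weak_conv (\<lambda>i. S (us i)) (S u)"
    and differentiable: "\<And>u. u \<in> L2_space \<Omega> \<Longrightarrow> L2_has_derivative \<Omega> S (S' u) u"
    and compact: "L2_compact_map \<Omega> S"
    and V_embedding: "L2_embedding \<Omega> \<iota>"
    and V_dual_embedding: "dual_embedding_Linf \<Omega> \<iota> \<kappa>"
    and adjoint_range: "\<And>u y. u \<in> L2_space \<Omega> \<Longrightarrow> \<exists>\<phi>. is_adjoint_value \<Omega> (S' u) y (\<kappa> \<phi>)"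
    and adjoint_conv: "\<And>us u y. L2_weak_conv \<Omega> us u \<Longrightarrow>
      \<exists>\<phi>. (\<forall>i. is_adjoint_value \<Omega> (\<lambda>h. S' (us i) h - S' u h) y (\<kappa> (\<phi> i))) \<and>
          (\<lambda>i. norm (\<phi> i)) \<longlonglongrightarrow> 0"
    and linear: "L2_linear \<Omega> S"
  shows "closure {z. \<exists>u. is_minimizer \<Omega> S g z u \<and> (AE x in lebesgue_on \<Omega>. u x \<in> M)} = UNIV \<and>
    (\<forall>z u. L2_inj \<Omega> S \<longrightarrow> is_minimizer \<Omega> S g z u \<longrightarrow>
       emeasure (lebesgue_on \<Omega>) (singular_arc \<Omega> M u) > 0 \<longrightarrow>
       \<not> (\<forall>zs us. zs \<longlonglongrightarrow> z \<longrightarrow> (\<forall>i. is_minimizer \<Omega> S g (zs i) (us i)) \<longrightarrow>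
            (\<lambda>i. L2_norm \<Omega> (\<lambda>x. us i x - u x)) \<longlonglongrightarrow> 0))"
proof -
  define a where "a v = \<alpha> * c v" for v
  have bounded_linear: "L2_bounded_linear \<Omega> S" and adjoint: "\<exists>p. is_adjoint_value \<Omega> S y p" for y
  proof -
    \<comment> \<open>A linear map is its own derivative, so the derivative at \<open>0\<close> supplies boundedness and adjoint.\<close>
    have 0: "(\<lambda>_. 0) \<in> L2_space \<Omega>" by (simp add: L2_space_def)
    note D = differentiable[OF 0]
    have eq: "S' (\<lambda>_. 0) h = S h" if "h \<in> L2_space \<Omega>" for h
      using L2_linear_derivative_unique[OF linear D 0 that] .
    show "L2_bounded_linear \<Omega> S"
      using D linear eq by (simp add: L2_has_derivative_def L2_bounded_linear_def)
    show "\<exists>p. is_adjoint_value \<Omega> S y p"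
      using adjoint_range[OF 0, of y] eq by (auto simp: is_adjoint_value_def)
  qed
  have cost: "finite_cost M a"
    using assms by unfold_locales (auto simp: a_def)
  have "divisible_measure (lebesgue_on \<Omega>)"
    using \<open>open \<Omega>\<close> \<open>bounded \<Omega>\<close> by (intro divisible_measure_lebesgue_on) auto
  then interpret multibang_problem M a \<Omega> S g
  proof (intro multibang_problem.intro multibang_problem_axioms.intro cost bounded_linear compact adjoint)
    show "e2ennreal (g v) = envelope M a v" for v
      using finite_cost.envelope_eq_biconjugate[OF cost] by (simp add: g multibang_penalty_def a_def)
  qed
  show ?thesis
  proof (intro conjI allI impI notI)
    let ?Z = "{z. \<exists>u. is_minimizer \<Omega> S g z u \<and> (AE x in lebesgue_on \<Omega>. u x \<in> M)}"
    have "z \<in> closure ?Z" for z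
      unfolding closure_approachable
    proof (intro allI impI)
      fix \<epsilon> :: real assume "\<epsilon> > 0"
      obtain u where "is_minimizer \<Omega> S g z u" using minimizer_exists by blast
      then obtain z' v where "dist z' z < \<epsilon>" "is_minimizer \<Omega> S g z' v"
        "\<And>x. x \<in> space \<mu> \<Longrightarrow> v x \<in> M"
        using multibang_minimizer_nearby \<open>\<epsilon> > 0\<close> by metis
      then show "\<exists>y\<in>?Z. dist y z < \<epsilon>" by (auto intro!: bexI[of _ z'] exI[of _ v] AE_I2)
    qed
    then show "closure ?Z = UNIV" by blast
  next
    fix z u
    assume u: "is_minimizer \<Omega> S g z u"
      and arc: "emeasure (lebesgue_on \<Omega>) (singular_arc \<Omega> M u) > 0"
      and stable: "\<forall>zs us. zs \<longlonglongrightarrow> z \<longrightarrow> (\<forall>i. is_minimizer \<Omega> S g (zs i) (us i)) \<longrightarrow>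
            (\<lambda>i. L2_norm \<Omega> (\<lambda>x. us i x - u x)) \<longlonglongrightarrow> 0"
    have "\<exists>z' v. dist z' z < inverse (real (Suc i)) \<and> is_minimizer \<Omega> S g z' v \<and> (\<forall>x\<in>space \<mu>. v x \<in> M)" for i
      using multibang_minimizer_nearby[OF u, of "inverse (real (Suc i))"] by (metis inverse_positive_iff_positive of_nat_0_less_iff zero_less_Suc)
    then obtain zs us where zs: "\<And>i. dist (zs i) z < inverse (real (Suc i))"
      and us: "\<And>i. is_minimizer \<Omega> S g (zs i) (us i)" "\<And>i x. x \<in> space \<mu> \<Longrightarrow> us i x \<in> M"
      by metis
    have "(\<lambda>i. dist (zs i) z) \<longlonglongrightarrow> 0"
      using zs by (intro Lim_null_comparison[OF _ LIMSEQ_inverse_real_of_nat]) (auto intro!: always_eventually less_imp_le)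
    then have "zs \<longlonglongrightarrow> z" by (rule iffD2[OF tendsto_dist_iff])
    then have lim: "(\<lambda>i. L2_norm \<Omega> (\<lambda>x. us i x - u x)) \<longlonglongrightarrow> 0"
      using stable us(1) by blast
    have L2: "u \<in> L2_space \<Omega>" "\<And>i. us i \<in> L2_space \<Omega>"
      using u us(1) by (auto simp: is_minimizer_def)
    have "AE x in lebesgue_on \<Omega>. u x \<in> M"
      using AE_in_closed_if_L2_limit[OF L2 _ M_nonempty us(2) lim] finite_M by (simp add: finite_imp_closed)
    then have "emeasure (lebesgue_on \<Omega>) (singular_arc \<Omega> M u) = 0"
      using emeasure_eq_0_AE[of "\<lambda>x. u x \<notin> M" "lebesgue_on \<Omega>"] by (simp add: singular_arc_def)
    then show False using arc by simp
  qed
qed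

end
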